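(* Let $\mathbb{F}_q$ be a finite field of order $q=p^s$ with $p$ prime. Let $P_1,\dots,P_r \in \mathbb{F}_q[t_1,\dots,t_n]$ be nonzero polynomials, and let $\mathcal{I}\subseteq\{1,\dots,n\}$ be a nonempty subset such that $\max_{1\le j\le r}\deg_{\mathcal{I}}(P_j)>0$. Let $f_1,\dots,f_n \in \mathbb{F}_q[t]$ and assume that $f_i$ is nonconstant for all $i\in\mathcal{I}$. Suppose that $(q-1)\sum_{j=1}^r \deg_{\mathcal{I}}(P_j) < \sum_{i\in\mathcal{I}} \omega(f_i)$. Then \[ q^{\left\lceil\left(\sum_{i\in\mathcal{I}} \frac{\omega(f_i)}{q-1}-\sum_{j=1}^r \deg_{\mathcal{I}}(P_j)\right)/\max_{1\le j\le r}\deg_{\mathcal{I}}(P_j)\right\rceil} \] divides $\# \{ (x_1,\dots,x_n) \in \mathbb{F}_q^n \mid P_j(f_1(x_1),\dots,f_n(x_n)) = 0 \text{ for all } 1 \leq j \leq r\}$.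
   Context: For nonconstant $f\in\mathbb{F}_q[t]$, write $f(t)=\sum_{\ell=1}^R b_{\ell}t^{m_{\ell}}$ with $b_{\ell}\neq 0$ and pairwise distinct exponents $m_\ell\geq 0$, and define $\omega(f)= \min\{\sum_{\ell=1}^R \gamma_{\ell} \mid 0\le\gamma_1,\dots,\gamma_R\le q-1 \text{ integers and } \sum_{\ell=1}^R m_{\ell}\gamma_{\ell}\in (q-1)\mathbb{Z}^+\}$ (one has $1\le\omega(f)\le q-1$). For nonempty $\mathcal{I}\subseteq\{1,\dots,n\}$ and a monomial $a t_1^{m_1}\cdots t_n^{m_n}$ with $a\neq 0$, its $\mathcal{I}$-degree is $\sum_{i\in\mathcal{I}} m_i$; for $P\in\mathbb{F}_q[t_1,\dots,t_n]$, $\deg_{\mathcal{I}}(P)$ is the maximum of the $\mathcal{I}$-degrees of its monomial terms. *)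

theory Defs
  imports
    "HOL-Library.Poly_Mapping"
    "HOL-Library.Cardinality"
    "HOL-Computational_Algebra.Computational_Algebra"
begin

text \<open>
  The ring of polynomials in variables indexed by a finite type \<open>'n\<close> with coefficients
  in \<open>'a\<close>: a finitely supported map from exponent vectors to coefficients.  Its ring
  structure (convolution product) is the one provided by the theory of polynomial mappings.
\<close>

type_synonym ('n, 'a) mpoly = "('n \<Rightarrow>\<^sub>0 nat) \<Rightarrow>\<^sub>0 'a"

definition mpoly_eval :: "('n::finite, 'a::comm_semiring_1) mpoly \<Rightarrow> ('n \<Rightarrow> 'a) \<Rightarrow> 'a" where
  "mpoly_eval P x =
     (\<Sum>m\<in>Poly_Mapping.keys P.
        Poly_Mapping.lookup P m * (\<Prod>i\<in>UNIV. x i ^ Poly_Mapping.lookup m i))"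

text \<open>Meaningful only for \<open>P \<noteq> 0\<close>; otherwise the maximum is over the empty set.\<close>

definition deg_on :: "'n::finite set \<Rightarrow> ('n, 'a::zero) mpoly \<Rightarrow> nat" where
  "deg_on I P = Max ((\<lambda>m. \<Sum>i\<in>I. Poly_Mapping.lookup m i) ` Poly_Mapping.keys P)"

definition exponents :: "'a::zero poly \<Rightarrow> nat set" where
  "exponents f = {m. coeff f m \<noteq> 0}"

text \<open>
  The integers \<open>\<gamma>\<^sub>\<ell>\<close> are indexed by the exponents \<open>m\<^sub>\<ell>\<close> themselves, which are pairwise
  distinct; values of \<open>\<gamma>\<close> off the support of \<open>f\<close> play no role.
\<close>

definition omega_sums :: "'a::{field,finite} poly \<Rightarrow> nat set" where
  "omega_sums f =
     {(\<Sum>m\<in>exponents f. \<gamma> m) | \<gamma> :: nat \<Rightarrow> nat.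
        (\<forall>m\<in>exponents f. \<gamma> m \<le> CARD('a) - 1) \<and>
        (\<exists>k>0. (\<Sum>m\<in>exponents f. m * \<gamma> m) = (CARD('a) - 1) * k)}"

definition omega :: "'a::{field,finite} poly \<Rightarrow> nat" where
  "omega f = Min (omega_sums f)"

lemma finite_exponents: "finite (exponents f)"
  unfolding exponents_def
  by (rule finite_subset[of _ "{..degree f}"]) (auto intro: le_degree)

lemma finite_omega_sums: "finite (omega_sums f)"
proof (rule finite_subset)
  show "omega_sums (f :: 'a poly) \<subseteq> {..card (exponents f) * (CARD('a) - 1)}"
    unfolding omega_sums_def using sum_bounded_above[of "exponents f" _ "CARD('a) - 1"] by auto
qed simp

lemma card_field_minus_1_in_omega_sums:
  fixes f :: "'a::{field,finite} poly"
  assumes "degree f > 0"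
  shows "CARD('a) - 1 \<in> omega_sums f"
proof -
  let ?g = "\<lambda>m. if m = degree f then CARD('a) - 1 else 0"
  have d: "degree f \<in> exponents f"
    using assms by (auto simp: exponents_def)
  have "(\<Sum>m\<in>exponents f. ?g m) = CARD('a) - 1"
    using d finite_exponents[of f] by (simp add: sum.delta)
  moreover have "(\<Sum>m\<in>exponents f. m * ?g m) = (CARD('a) - 1) * degree f"
    using d finite_exponents[of f] by (simp add: if_distrib sum.delta mult.commute cong: if_cong)
  ultimately show ?thesis
    unfolding omega_sums_def using assms by (intro CollectI exI[of _ ?g]) auto
qed

lemma card_field_ge_2: "CARD('a::{field,finite}) \<ge> 2"
proof -
  have "card {0, 1 :: 'a} \<le> CARD('a)" by (rule card_mono) auto
  then show ?thesis by simp
qed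

lemma omega_bounds:
  fixes f :: "'a::{field,finite} poly"
  assumes "degree f > 0"
  shows "1 \<le> omega f" and "omega f \<le> CARD('a) - 1"
proof -
  show "omega f \<le> CARD('a) - 1"
    unfolding omega_def
    by (rule Min_le[OF finite_omega_sums card_field_minus_1_in_omega_sums[OF assms]])
  have "omega f \<in> omega_sums f"
    unfolding omega_def
    using Min_in[OF finite_omega_sums] card_field_minus_1_in_omega_sums[OF assms] by blast
  then obtain g :: "nat \<Rightarrow> nat" and k where g: "omega f = (\<Sum>m\<in>exponents f. g m)" "k > 0"
      "(\<Sum>m\<in>exponents f. m * g m) = (CARD('a) - 1) * k"
    unfolding omega_sums_def by blast
  have "omega f \<noteq> 0"
  proof
    assume "omega f = 0"
    then have "\<forall>m\<in>exponents f. g m = 0" using g(1) finite_exponents[of f] by simp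
    then have "(CARD('a) - 1) * k = 0" using g(3) by simp
    then show False using g(2) card_field_ge_2[where 'a = 'a] by simp
  qed
  then show "1 \<le> omega f" by simp
qed

end

theory Submission
  imports "HOL-Algebra.Algebraic_Closure_Type" Defs
begin

text \<open>
  As in Wan's proof of the Ax--Katz theorem, \<open>q\<^sup>r\<close> times the number of zeros is the exponential
  sum of \<open>\<psi>(\<Sum>\<^sub>j y\<^sub>j P\<^sub>j(f(x)))\<close> over \<open>x\<close> and \<open>y\<close>. On Teichmueller representatives, \<open>\<psi>\<close> is a
  polynomial of degree \<open>q - 1\<close> whose coefficients are essentially Gauss sums; by Stickelberger's
  theorem the coefficient of \<open>T\<^sup>e\<close> is divisible by \<open>(\<xi> - 1)\<^bsup>\<sigma>(e)\<^esup>\<close>, where \<open>\<sigma>(e)\<close> is the sum of the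
  base-\<open>p\<close> digits of \<open>e\<close> and \<open>\<xi>\<close> a primitive \<open>p\<close>-th root of unity. After expansion into monomials, a
  family of exponents \<open>e\<^sub>k\<close> contributes only if the total degree in every variable is a multiple of
  \<open>q - 1\<close>. This forces the total of the \<open>e\<^sub>k\<close> to be large: a variable \<open>x\<^sub>i\<close> with \<open>i \<in> I\<close> that occurs
  uses up at least \<open>\<omega>(f\<^sub>i)\<close> factors, and one that does not occur contributes a factor \<open>q\<close>. The
  condition is stable under cyclic rotation of the digits, and averaging over rotations turns the
  bound on \<open>\<Sum>\<^sub>k e\<^sub>k\<close> into one on \<open>\<Sum>\<^sub>k \<sigma>(e\<^sub>k)\<close>, losing nothing to rounding.
\<close>

section \<open>Finite fields\<close>

lemma power_mod_exponent:
  fixes a :: "'a::monoid_mult"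
  assumes "a ^ n = 1"
  shows "a ^ (k mod n) = a ^ k"
proof -
  have "a ^ k = (a ^ n) ^ (k div n) * a ^ (k mod n)" by (simp flip: power_mult power_add)
  then show ?thesis by (simp add: assms)
qed

lemma finite_field_CHAR:
  assumes "prime p" "CARD('a::{field,finite}) = p ^ s"
  shows "CHAR('a) = p"
proof -
  have "(\<Sum>x\<in>(UNIV::'a set). x + 1) = (\<Sum>x\<in>UNIV. x)"
    by (rule sum.reindex_bij_witness[of _ "\<lambda>x. x - 1" "\<lambda>x. x + 1"]) auto
  then have "(of_nat CARD('a) :: 'a) = 0" by (simp add: sum.distrib)
  then have "CHAR('a) dvd p ^ s" by (simp only: of_nat_eq_0_iff_char_dvd assms)
  moreover have "prime CHAR('a)"
    by (intro prime_CHAR_semidom finite_imp_CHAR_pos) simp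
  ultimately show ?thesis
    using assms(1) by (metis prime_dvd_power primes_dvd_imp_eq)
qed

lemma finite_field_power_CARD_minus_1:
  fixes x :: "'a::{field,finite}"
  assumes "x \<noteq> 0"
  shows "x ^ (CARD('a) - 1) = 1"
proof -
  have "(\<Prod>y\<in>UNIV - {0}. x * y) = (\<Prod>y\<in>UNIV - {0}. y)"
    by (rule prod.reindex_bij_witness[of _ "\<lambda>y. y / x" "\<lambda>y. x * y"]) (use assms in auto)
  then have "x ^ (CARD('a) - 1) * \<Prod>(UNIV - {0}) = 1 * \<Prod>(UNIV - {0})"
    by (simp add: prod.distrib)
  moreover have "\<Prod>(UNIV - {0 :: 'a}) \<noteq> 0" by simp
  ultimately show ?thesis by (metis mult_right_cancel)
qed

definition primitive_element :: "'a::field \<Rightarrow> bool" where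
  "primitive_element g \<longleftrightarrow> g \<noteq> 0 \<and> (\<forall>a. a \<noteq> 0 \<longrightarrow> (\<exists>k::nat. a = g ^ k))"

lemma ex_primitive_element: "\<exists>g :: 'a::{field,finite}. primitive_element g"
proof -
  let ?R = "ring_of_type_algebra :: 'a ring"
  interpret F: field ?R ..
  have power: "a [^]\<^bsub>?R\<^esub> k = a ^ k" for a and k :: nat
    by (induction k) (simp_all add: nat_pow_def ring_of_type_algebra_def mult.commute)
  have units: "carrier (Multiplicative_Group.mult_of ?R) = UNIV - {0}"
    by simp (simp add: ring_of_type_algebra_def)
  have "finite (carrier ?R)" by simp
  from F.finite_field_mult_group_has_gen[OF this]
  obtain g where "g \<in> UNIV - {0}" "UNIV - {0} = {g [^]\<^bsub>?R\<^esub> k | k::nat. k \<in> UNIV}"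
    unfolding units by blast
  then have "primitive_element g"
    unfolding primitive_element_def power by blast
  then show ?thesis ..
qed

lemma primitive_element_power_eq_iff:
  fixes g :: "'a::{field,finite}"
  assumes "primitive_element g"
  shows "g ^ k = g ^ l \<longleftrightarrow> k mod (CARD('a) - 1) = l mod (CARD('a) - 1)"
proof -
  define n where "n = CARD('a) - 1"
  have n_pos: "n > 0" using card_field_ge_2[where 'a = 'a] by (simp add: n_def)
  have g_power_n: "g ^ n = 1"
    using assms finite_field_power_CARD_minus_1[of g] by (simp add: primitive_element_def n_def)
  have "(\<lambda>k. g ^ k) ` {..<n} = UNIV - {0}"
  proof
    show "UNIV - {0} \<subseteq> (\<lambda>k. g ^ k) ` {..<n}"
    proof
      fix a :: 'a assume "a \<in> UNIV - {0}"
      then obtain k where "a = g ^ k" using assms by (auto simp: primitive_element_def)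
      then have "a = g ^ (k mod n)" by (simp add: power_mod_exponent g_power_n)
      then show "a \<in> (\<lambda>k. g ^ k) ` {..<n}" using n_pos by auto
    qed
  qed (use assms in \<open>auto simp: primitive_element_def\<close>)
  then have "card ((\<lambda>k. g ^ k) ` {..<n}) = card {..<n}" by (simp add: n_def)
  then have "inj_on (\<lambda>k. g ^ k) {..<n}" by (intro eq_card_imp_inj_on) auto
  then have "g ^ (k mod n) = g ^ (l mod n) \<longleftrightarrow> k mod n = l mod n"
    using n_pos by (auto dest: inj_onD)
  then have "g ^ k = g ^ l \<longleftrightarrow> k mod n = l mod n"
    by (simp only: power_mod_exponent[OF g_power_n])
  then show ?thesis by (simp only: n_def)
qed

lemma finite_field_character_exists:
  fixes g :: "'a::{field,finite}" and \<zeta> :: "'b::comm_semiring_1"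
  assumes g: "primitive_element g" and \<zeta>: "\<zeta> ^ (CARD('a) - 1) = 1"
  obtains \<chi> where "\<chi> 0 = 0" "\<And>k. \<chi> (g ^ k) = \<zeta> ^ k" "\<And>x y. \<chi> (x * y) = \<chi> x * \<chi> y"
proof -
  define n where "n = CARD('a) - 1"
  define \<chi> where "\<chi> x = (if x = 0 then 0 else \<zeta> ^ (SOME k. x = g ^ k))" for x
  have zero: "\<chi> 0 = 0" by (simp add: \<chi>_def)
  have power: "\<chi> (g ^ k) = \<zeta> ^ k" for k
  proof -
    define l where "l = (SOME l. g ^ k = g ^ l)"
    have "g ^ k = g ^ l" unfolding l_def by (rule someI[of _ k]) simp
    then have "k mod n = l mod n"
      using primitive_element_power_eq_iff[OF g] by (simp add: n_def)
    then have "\<zeta> ^ k = \<zeta> ^ l" using \<zeta> by (metis n_def power_mod_exponent)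
    moreover have "\<chi> (g ^ k) = \<zeta> ^ l"
      using g by (simp add: \<chi>_def l_def primitive_element_def)
    ultimately show ?thesis by simp
  qed
  have mult: "\<chi> (x * y) = \<chi> x * \<chi> y" for x y
  proof (cases "x = 0 \<or> y = 0")
    case False
    then obtain k l where "x = g ^ k" "y = g ^ l" using g unfolding primitive_element_def by blast
    then show ?thesis using power[of "k + l"] by (simp add: power power_add)
  qed (auto simp: zero)
  from zero power mult show ?thesis by (rule that)
qed

lemma power_CHAR_eq_self_iff:
  fixes x :: "'a::idom"
  assumes "CHAR('a) > 0"
  shows "x ^ CHAR('a) = x \<longleftrightarrow> x \<in> of_nat ` {..<CHAR('a)}"
proof -
  define p where "p = CHAR('a)"
  have p: "prime p" unfolding p_def by (rule prime_CHAR_semidom) (use assms in auto)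
  have p_ge_2: "p \<ge> 2" using p by (rule prime_ge_2_nat)
  define P :: "'a poly" where "P = monom 1 p - monom 1 1"
  have roots: "poly P x = 0 \<longleftrightarrow> x ^ p = x" for x by (simp add: P_def poly_monom)
  have "coeff P p = 1" using p_ge_2 by (simp add: P_def)
  then have P_neq_0: "P \<noteq> 0" by auto
  have "degree P \<le> p"
    unfolding P_def using p_ge_2 by (intro degree_diff_le) (auto simp: degree_monom_eq)
  then have "card {x. poly P x = 0} \<le> p" using card_poly_roots_bound[OF P_neq_0] by simp
  moreover have "inj_on (of_nat :: nat \<Rightarrow> 'a) {..<p}"
    by (rule linorder_inj_onI)
      (auto simp: of_nat_eq_iff_char_dvd simp flip: p_def dest!: dvd_imp_le)
  then have "card (of_nat ` {..<p} :: 'a set) = p" by (simp add: card_image)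
  moreover have "of_nat ` {..<p} \<subseteq> {x. poly P x = 0}"
  proof -
    have "(of_nat k :: 'a) ^ p = of_nat k" for k
    proof (induction k)
      case (Suc k)
      have "(1 + of_nat k :: 'a) ^ p = 1 ^ p + of_nat k ^ p"
        by (intro freshmans_dream) (use p in \<open>auto simp: p_def\<close>)
      with Suc show ?case by simp
    qed (use p_ge_2 in auto)
    then show ?thesis by (auto simp: roots)
  qed
  ultimately have "of_nat ` {..<p} = {x. poly P x = 0}"
    by (intro card_seteq) (simp_all add: poly_roots_finite P_neq_0)
  then show ?thesis using roots[of x] by (auto simp: p_def)
qed

section \<open>Digit sums\<close>

definition digit_sum :: "nat \<Rightarrow> nat \<Rightarrow> nat \<Rightarrow> nat" where
  "digit_sum p s e = (\<Sum>i<s. (e div p ^ i) mod p)"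

lemma digit_sum_0 [simp]: "digit_sum p s 0 = 0"
  by (simp add: digit_sum_def)

lemma digit_sum_Suc_length: "digit_sum p (Suc s) e = e mod p + digit_sum p s (e div p)"
  by (simp only: digit_sum_def sum.lessThan_Suc_shift) (simp add: div_mult2_eq)

lemma digit_sum_base_mult:
  assumes "p > 0" "p * e < p ^ s"
  shows "digit_sum p s (p * e) = digit_sum p s e"
proof (cases s)
  case (Suc s')
  then have "e < p ^ s'" using assms by simp
  then have "digit_sum p s e = digit_sum p s' e" by (simp add: digit_sum_def Suc)
  then show ?thesis using assms(1) by (simp add: Suc digit_sum_Suc_length)
qed (use assms in auto)

lemma digit_sum_Suc:
  assumes "s > 0" "\<not> p dvd Suc e"
  shows "digit_sum p s (Suc e) = Suc (digit_sum p s e)"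
proof -
  have "Suc e mod p = Suc (e mod p)" using assms(2) by (metis dvd_eq_mod_eq_0 mod_Suc)
  moreover have "Suc e div p = e div p" using assms(2) by (metis dvd_eq_mod_eq_0 div_Suc)
  ultimately show ?thesis using assms(1) by (cases s) (simp_all add: digit_sum_Suc_length)
qed

lemma digit_sum_power_minus_1:
  assumes "p > 0"
  shows "digit_sum p s (p ^ s - 1) = s * (p - 1)"
proof (induction s)
  case (Suc s)
  have "p * 1 \<le> p * p ^ s" using assms by (intro mult_left_mono) auto
  then have "p ^ Suc s - 1 = p * (p ^ s - 1) + (p - 1)"
    using assms by (simp add: diff_mult_distrib2)
  then have "(p ^ Suc s - 1) mod p = p - 1" "(p ^ Suc s - 1) div p = p ^ s - 1"
    using assms by (simp_all only: mod_mult_self4 div_mult_self4) simp_all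
  then show ?case by (simp only: digit_sum_Suc_length Suc.IH mult_Suc)
qed (simp add: digit_sum_def)

definition rotate_digits :: "nat \<Rightarrow> nat \<Rightarrow> nat \<Rightarrow> nat \<Rightarrow> nat" where
  "rotate_digits p s t e = e div p ^ t + p ^ (s - t) * (e mod p ^ t)"

lemma power_mult_rotate_digits:
  assumes "p > 0" "t \<le> s"
  shows "p ^ t * rotate_digits p s t e = e + (p ^ s - 1) * (e mod p ^ t)"
proof -
  have "p ^ t * rotate_digits p s t e = p ^ t * (e div p ^ t) + p ^ s * (e mod p ^ t)"
    using assms(2) by (simp add: rotate_digits_def distrib_left flip: power_add mult.assoc)
  also have "p ^ s = (p ^ s - 1) + 1" using assms(1) by simp
  also have "p ^ t * (e div p ^ t) + (p ^ s - 1 + 1) * (e mod p ^ t)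
      = p ^ t * (e div p ^ t) + e mod p ^ t + (p ^ s - 1) * (e mod p ^ t)"
    by (simp only: distrib_right)
  finally show ?thesis by simp
qed

lemma rotate_digits_Suc:
  assumes "p > 0" "t < s"
  shows "p * rotate_digits p s (Suc t) e
    = rotate_digits p s t e + (p ^ s - 1) * ((e div p ^ t) mod p)"
proof -
  have "p ^ t * (p * rotate_digits p s (Suc t) e) = e + (p ^ s - 1) * (e mod p ^ Suc t)"
    using power_mult_rotate_digits[of p "Suc t" s e] assms by (simp add: mult_ac)
  also have "e mod p ^ Suc t = p ^ t * ((e div p ^ t) mod p) + e mod p ^ t"
    using mod_mult2_eq[of e "p ^ t" p] by (simp add: mult.commute)
  also have "e + (p ^ s - 1) * (p ^ t * ((e div p ^ t) mod p) + e mod p ^ t)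
      = p ^ t * (rotate_digits p s t e + (p ^ s - 1) * ((e div p ^ t) mod p))"
    using power_mult_rotate_digits[of p t s e] assms
    by (simp add: distrib_left mult.left_commute)
  finally show ?thesis using assms(1) by simp
qed

lemma sum_rotate_digits:
  assumes "p > 0" "e < p ^ s"
  shows "(p - 1) * (\<Sum>t<s. rotate_digits p s t e) = (p ^ s - 1) * digit_sum p s e"
proof -
  let ?r = "\<lambda>t. rotate_digits p s t e"
  have "p * (\<Sum>t<s. ?r (Suc t)) = (\<Sum>t<s. ?r t) + (p ^ s - 1) * digit_sum p s e"
    using assms(1) by (simp add: sum_distrib_left rotate_digits_Suc sum.distrib digit_sum_def)
  moreover have "(\<Sum>t<s. ?r (Suc t)) = (\<Sum>t<s. ?r t)"
  proof -
    have "?r 0 + (\<Sum>t<s. ?r (Suc t)) = (\<Sum>t<s. ?r t) + ?r s"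
      using sum.lessThan_Suc_shift[of ?r s] sum.lessThan_Suc[of ?r s] by simp
    moreover have "?r 0 = ?r s" using assms(2) by (simp add: rotate_digits_def)
    ultimately show ?thesis by simp
  qed
  ultimately show ?thesis by (simp add: diff_mult_distrib)
qed

lemma rotate_digits_eq_0_iff:
  assumes "p > 0" "t \<le> s"
  shows "rotate_digits p s t e = 0 \<longleftrightarrow> e = 0"
  using power_mult_rotate_digits[OF assms, of e] assms(1) by (auto simp: rotate_digits_def)

lemma dvd_sum_rotate_digits:
  assumes "p > 0" "t \<le> s" "(p ^ s - 1) dvd (\<Sum>k\<in>K. e k * w k)"
  shows "(p ^ s - 1) dvd (\<Sum>k\<in>K. rotate_digits p s t (e k) * w k)"
proof -
  have "p ^ t * (\<Sum>k\<in>K. rotate_digits p s t (e k) * w k)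
      = (\<Sum>k\<in>K. (p ^ t * rotate_digits p s t (e k)) * w k)"
    by (simp add: sum_distrib_left mult.assoc)
  also have "\<dots> = (\<Sum>k\<in>K. e k * w k) + (p ^ s - 1) * (\<Sum>k\<in>K. (e k mod p ^ t) * w k)"
    by (simp only: power_mult_rotate_digits[OF assms(1,2)] distrib_right sum.distrib
        sum_distrib_left mult.assoc)
  finally have "(p ^ s - 1) dvd p ^ t * (\<Sum>k\<in>K. rotate_digits p s t (e k) * w k)"
    using assms(3) by simp
  moreover have "coprime (p ^ s - 1) (p ^ t)"
  proof -
    have "coprime (p ^ s - 1) (p ^ s)" using assms(1) by (intro coprime_diff_one_left_nat) simp
    moreover have "p ^ t dvd p ^ s" using assms(2) by (rule le_imp_power_dvd)
    ultimately show ?thesis using coprime_divisors dvd_refl by blast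
  qed
  ultimately show ?thesis by (simp add: coprime_dvd_mult_right_iff)
qed

section \<open>Reduction of algebraic integers\<close>

definition eval_int_poly :: "int poly \<Rightarrow> 'b::comm_ring_1 \<Rightarrow> 'b" where
  "eval_int_poly h x = poly (map_poly of_int h) x"

lemma eval_int_poly_0 [simp]: "eval_int_poly 0 x = 0"
  by (simp add: eval_int_poly_def)

lemma eval_int_poly_pCons [simp]: "eval_int_poly (pCons a h) x = of_int a + x * eval_int_poly h x"
  by (simp add: eval_int_poly_def map_poly_pCons)

lemma eval_int_poly_1 [simp]: "eval_int_poly 1 x = 1"
  by (simp add: one_pCons)

lemma eval_int_poly_add [simp]: "eval_int_poly (h + k) x = eval_int_poly h x + eval_int_poly k x"
  by (induction h k rule: poly_induct2) (auto simp: algebra_simps)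

lemma eval_int_poly_smult [simp]: "eval_int_poly (smult c h) x = of_int c * eval_int_poly h x"
  by (induction h) (auto simp: algebra_simps)

lemma eval_int_poly_diff [simp]: "eval_int_poly (h - k) x = eval_int_poly h x - eval_int_poly k x"
  using eval_int_poly_add[of "h - k" k x] by (simp del: eval_int_poly_add)

lemma eval_int_poly_mult [simp]: "eval_int_poly (h * k) x = eval_int_poly h x * eval_int_poly k x"
  by (induction h) (auto simp: algebra_simps)

lemma eval_int_poly_monom [simp]: "eval_int_poly (monom c k) x = of_int c * x ^ k"
  by (simp add: eval_int_poly_def map_poly_monom poly_monom)

lemma eval_int_poly_sum [simp]:
  "eval_int_poly (\<Sum>i\<in>B. h i) x = (\<Sum>i\<in>B. eval_int_poly (h i) x)"
  by (induction B rule: infinite_finite_induct) auto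

lemma eval_int_poly_prod_mset: "eval_int_poly (prod_mset M) x = (\<Prod>h\<in>#M. eval_int_poly h x)"
  by (induction M) auto

lemma minimal_int_poly_exists:
  fixes w :: "'b::{idom,ring_char_0}"
  assumes "f \<noteq> 0" "eval_int_poly f w = 0"
  obtains \<mu> where "degree \<mu> > 0"
    "\<And>h. eval_int_poly h w = 0 \<Longrightarrow> \<exists>c. c \<noteq> 0 \<and> \<mu> dvd [:c:] * h"
proof -
  define S where "S = {h. h \<noteq> 0 \<and> eval_int_poly h w = 0}"
  define \<mu> where "\<mu> = arg_min degree (\<lambda>h. h \<in> S)"
  have "f \<in> S" using assms by (simp add: S_def)
  then have "\<mu> \<in> S" unfolding \<mu>_def by (rule arg_min_natI)
  then have \<mu>: "\<mu> \<noteq> 0" "eval_int_poly \<mu> w = 0" by (simp_all add: S_def)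
  have \<mu>_minimal: "degree \<mu> \<le> degree h" if "h \<in> S" for h
    unfolding \<mu>_def using that by (rule arg_min_nat_le)
  have "degree \<mu> > 0"
  proof (rule ccontr)
    assume "\<not> degree \<mu> > 0"
    then obtain c where "\<mu> = [:c:]" by (auto elim: degree_eq_zeroE)
    with \<mu> show False by simp
  qed
  moreover have "\<exists>c. c \<noteq> 0 \<and> \<mu> dvd [:c:] * h" if "eval_int_poly h w = 0" for h
  proof -
    obtain c k where c: "c \<noteq> 0" and division: "smult c h = \<mu> * k + pseudo_mod h \<mu>"
      using pseudo_mod(1)[OF \<mu>(1)] by blast
    have "eval_int_poly (smult c h) w = eval_int_poly (\<mu> * k + pseudo_mod h \<mu>) w"
      by (simp only: division)
    then have "eval_int_poly (pseudo_mod h \<mu>) w = 0" using that \<mu>(2) by simp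
    moreover have "pseudo_mod h \<mu> = 0 \<or> degree (pseudo_mod h \<mu>) < degree \<mu>"
      by (rule pseudo_mod(2)[OF \<mu>(1)])
    ultimately have "pseudo_mod h \<mu> = 0"
      using \<mu>_minimal[of "pseudo_mod h \<mu>"] by (fastforce simp: S_def)
    with c division show ?thesis by auto
  qed
  ultimately show ?thesis by (rule that)
qed

lemma prime_elem_int_poly_dvd:
  fixes w :: "'b::{idom,ring_char_0}"
  assumes prime_f: "prime_elem f" and deg_f: "degree f > 0"
    and root_f: "eval_int_poly f w = 0" and root_h: "eval_int_poly h w = 0"
  shows "f dvd h"
proof -
  have f_neq_0: "f \<noteq> 0" using prime_f by auto
  obtain \<mu> where deg_\<mu>: "degree \<mu> > 0"
      and \<mu>_dvd: "\<And>h. eval_int_poly h w = 0 \<Longrightarrow> \<exists>c. c \<noteq> 0 \<and> \<mu> dvd [:c:] * h"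
    using minimal_int_poly_exists[OF f_neq_0 root_f] by blast
  have not_dvd_const: "\<not> g dvd [:c:]" if "degree g > 0" "c \<noteq> 0" for g and c :: int
    using dvd_imp_degree_le[of g "[:c:]"] that by auto
  have "f dvd \<mu>"
  proof (rule ccontr)
    assume "\<not> f dvd \<mu>"
    obtain c k where c: "c \<noteq> 0" and c_mult_f: "[:c:] * f = \<mu> * k"
      using \<mu>_dvd[OF root_f] unfolding dvd_def by blast
    have "f dvd \<mu> * k" unfolding c_mult_f[symmetric] by (rule dvd_triv_right)
    then obtain l where "k = f * l"
      using prime_f \<open>\<not> f dvd \<mu>\<close> by (auto simp: prime_elem_dvd_mult_iff)
    then have "f * [:c:] = f * (\<mu> * l)"
      using c_mult_f by (simp only: mult.left_commute mult.commute)
    then have "[:c:] = \<mu> * l" using f_neq_0 by (simp only: mult_cancel_left) simp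
    then show False using not_dvd_const[OF deg_\<mu> c] by simp
  qed
  moreover obtain c where c: "c \<noteq> 0" "\<mu> dvd [:c:] * h" using \<mu>_dvd[OF root_h] by blast
  ultimately have "f dvd [:c:] * h" by (metis dvd_trans)
  then show ?thesis using not_dvd_const[OF deg_f c(1)] prime_f prime_elem_dvd_mult_iff by blast
qed

lemma int_poly_prime_factor_with_root:
  fixes x :: "'c::idom"
  assumes Q: "content Q = 1" "eval_int_poly Q x = 0"
  obtains f where "prime_elem f" "degree f > 0" "f dvd Q" "eval_int_poly f x = 0"
proof -
  have "Q \<noteq> 0" using Q(1) by auto
  then obtain M where prime_M: "\<And>h. h \<in># M \<Longrightarrow> prime_elem h"
      and "normalize (prod_mset M) = normalize Q"
    using prime_factorization_exists by blast
  then have associated: "Q dvd prod_mset M" "prod_mset M dvd Q"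
    by (auto dest: associatedD1 associatedD2)
  have "eval_int_poly (prod_mset M) x = 0" using associated(1) Q(2) by auto
  then obtain f where f: "f \<in># M" "eval_int_poly f x = 0"
    by (auto simp: eval_int_poly_prod_mset)
  have "f dvd Q" using dvd_prod_mset[OF f(1)] associated(2) by (rule dvd_trans)
  moreover have "degree f > 0"
  proof (rule ccontr)
    assume "\<not> degree f > 0"
    then obtain c where c: "f = [:c:]" by (auto elim: degree_eq_zeroE)
    have "c dvd 1" using \<open>f dvd Q\<close> by (simp add: c const_poly_dvd_iff_dvd_content Q(1))
    then have "is_unit f" unfolding c by (simp only: is_unit_const_poly_iff)
    then show False using prime_M[OF f(1)] by (auto simp: prime_elem_def)
  qed
  ultimately show ?thesis using that prime_M[OF f(1)] f(2) by blast
qed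

text \<open>Choosing \<open>w\<close> as a root of a prime factor of \<open>Q\<close> makes \<open>h(w) \<mapsto> h(x)\<close> well defined on \<open>\<int>[w]\<close>;
  in particular no irreducibility of cyclotomic polynomials is needed.\<close>

lemma int_poly_specialization:
  fixes x :: "'c::idom"
  assumes "content Q = 1" "eval_int_poly Q x = 0"
  obtains w :: complex and \<phi> where "eval_int_poly Q w = 0"
    "\<And>h. \<phi> (eval_int_poly h w) = eval_int_poly h x"
proof -
  obtain f where f: "prime_elem f" "degree f > 0" "f dvd Q" "eval_int_poly f x = 0"
    using assms by (rule int_poly_prime_factor_with_root)
  have "\<not> constant (poly (map_poly of_int f :: complex poly))"
    using f(2) by (simp add: constant_degree degree_map_poly)
  then obtain w :: complex where w: "eval_int_poly f w = 0"
    using fundamental_theorem_of_algebra unfolding eval_int_poly_def by blast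
  define \<phi> where "\<phi> a = eval_int_poly (SOME h. eval_int_poly h w = a) x" for a
  have "\<phi> (eval_int_poly h w) = eval_int_poly h x" for h
  proof -
    define k where "k = (SOME k. eval_int_poly k w = eval_int_poly h w)"
    have "eval_int_poly k w = eval_int_poly h w" unfolding k_def by (rule someI) (rule refl)
    then have "f dvd k - h" by (intro prime_elem_int_poly_dvd[OF f(1,2) w]) simp
    then have "eval_int_poly (k - h) x = 0"
      using f(4) by (auto simp del: eval_int_poly_diff)
    then show ?thesis by (simp add: \<phi>_def k_def)
  qed
  moreover have "eval_int_poly Q w = 0" using f(3) w by auto
  ultimately show ?thesis using that by blast
qed

lemma content_geometric_int_poly:
  assumes "n > 0" "m > 0"
  shows "content (\<Sum>i<m. monom 1 (n * i) :: int poly) = 1"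
proof -
  have "coeff (\<Sum>i<m. monom 1 (n * i) :: int poly) 0 = (\<Sum>i<m. if i = 0 then 1 else 0)"
    unfolding coeff_sum using assms(1) by (intro sum.cong) auto
  also have "\<dots> = 1" using assms(2) by simp
  finally show ?thesis by (metis content_dvd_coeff is_unit_content_iff)
qed

lemma root_of_unity_specialization:
  fixes g :: "'c::idom"
  assumes "n > 0" "m > 0" "of_nat m = (0 :: 'c)" "g ^ n = 1"
  obtains w :: complex and \<phi> where "w ^ n \<noteq> 1" "(w ^ n) ^ m = 1"
    "\<And>h. \<phi> (eval_int_poly h w) = eval_int_poly h g"
proof -
  define Q :: "int poly" where "Q = (\<Sum>i<m. monom 1 (n * i))"
  have eval_Q: "eval_int_poly Q y = (\<Sum>i<m. (y ^ n) ^ i)" for y :: "'d::comm_ring_1"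
    by (simp add: Q_def power_mult)
  have "content Q = 1" unfolding Q_def using assms(1,2) by (rule content_geometric_int_poly)
  moreover have "eval_int_poly Q g = 0" using assms(3,4) by (simp add: eval_Q)
  ultimately obtain w :: complex and \<phi> where w: "eval_int_poly Q w = 0"
      and \<phi>: "\<And>h. \<phi> (eval_int_poly h w) = eval_int_poly h g"
    using int_poly_specialization by blast
  have "(w ^ n) ^ m = 1" using power_diff_1_eq[of "w ^ n" m] w by (simp add: eval_Q)
  moreover have "w ^ n \<noteq> 1" using w assms(2) by (auto simp: eval_Q)
  ultimately show ?thesis using that \<phi> by blast
qed

text \<open>\<open>A\<close> stands in for the ring \<open>\<int>\<^sub>p[\<zeta>]\<close> generated by a primitive \<open>p(q-1)\<close>-th root of unity \<open>\<zeta>\<close>: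
  the argument needs no completeness, only a reduction map with a multiplicative section \<open>T\<close>.\<close>

locale teichmueller =
  fixes p s :: nat and A :: "'b::{idom,ring_char_0} set" and red :: "'b \<Rightarrow> 'a::{field,finite}"
    and T :: "'a \<Rightarrow> 'b" and \<xi> :: 'b
  assumes prime_p: "prime p" and card_field: "CARD('a) = p ^ s"
    and one_closed [simp]: "1 \<in> A"
    and diff_closed [simp]: "a \<in> A \<Longrightarrow> b \<in> A \<Longrightarrow> a - b \<in> A"
    and mult_closed [simp]: "a \<in> A \<Longrightarrow> b \<in> A \<Longrightarrow> a * b \<in> A"
    and red_1 [simp]: "red 1 = 1"
    and red_diff [simp]: "a \<in> A \<Longrightarrow> b \<in> A \<Longrightarrow> red (a - b) = red a - red b"
    and red_mult [simp]: "a \<in> A \<Longrightarrow> b \<in> A \<Longrightarrow> red (a * b) = red a * red b"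
    and T_closed [simp]: "T x \<in> A"
    and T_0 [simp]: "T 0 = 0"
    and T_mult: "T (x * y) = T x * T y"
    and red_T [simp]: "red (T x) = x"
    and \<xi>_closed [simp]: "\<xi> \<in> A"
    and \<xi>_power_p: "\<xi> ^ p = 1"
    and \<xi>_neq_1: "\<xi> \<noteq> 1"
    and red_\<xi> [simp]: "red \<xi> = 1"

lemma power_prime_power_eq_1:
  fixes w :: "'b::comm_monoid_mult"
  assumes "(w ^ n) ^ p = 1" "s > 0"
  shows "(w ^ p ^ s) ^ n = 1"
proof -
  have "(w ^ p ^ s) ^ n = ((w ^ n) ^ p) ^ p ^ (s - 1)"
    using assms(2) by (cases s) (simp_all add: mult_ac flip: power_mult)
  then show ?thesis by (simp only: assms(1) power_one)
qed

text \<open>The ring is \<open>\<int>[w]\<close> for a root \<open>w\<close> of \<open>(X\<^bsup>p(q-1)\<^esup> - 1) / (X\<^bsup>q-1\<^esup> - 1)\<close>, reduced by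
  sending \<open>w\<close> to a primitive element of the field.\<close>

lemma teichmueller_exists:
  assumes p: "prime p" and card: "CARD('a::{field,finite}) = p ^ s"
  obtains A and red :: "complex \<Rightarrow> 'a::{field,finite}" and T \<xi>
  where "teichmueller p s A red T \<xi>"
proof -
  obtain g :: 'a where g: "primitive_element g" using ex_primitive_element by blast
  define n where "n = CARD('a) - 1"
  have n: "n > 0" "p ^ s = Suc n"
    using card_field_ge_2[where 'a = 'a] by (simp_all add: n_def card)
  have g_power_n: "g ^ n = 1"
    using finite_field_power_CARD_minus_1[of g] g by (simp add: primitive_element_def n_def)
  obtain w :: complex and red :: "complex \<Rightarrow> 'a" where
    w: "w ^ n \<noteq> 1" "(w ^ n) ^ p = 1" and red: "\<And>h. red (eval_int_poly h w) = eval_int_poly h g"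
    using root_of_unity_specialization[OF n(1) prime_gt_0_nat[OF p] _ g_power_n]
      finite_field_CHAR[OF p card] of_nat_CHAR[where 'a = 'a] by blast
  define A where "A = range (\<lambda>h. eval_int_poly h w)"
  have eval_A: "eval_int_poly h w \<in> A" for h by (simp add: A_def)
  have power_A: "w ^ k \<in> A" and red_power: "red (w ^ k) = g ^ k" for k
    using eval_A[of "monom 1 k"] red[of "monom 1 k"] by simp_all
  have "s > 0" using n by (cases s) auto
  with w(2) have "(w ^ p ^ s) ^ n = 1" by (rule power_prime_power_eq_1)
  then obtain T where T: "T 0 = 0" "\<And>k. T (g ^ k) = (w ^ p ^ s) ^ k"
      "\<And>x y. T (x * y) = T x * T y"
    unfolding n_def using finite_field_character_exists[OF g] by blast
  have T_red: "T x \<in> A \<and> red (T x) = x" for x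
  proof (cases "x = 0")
    case True
    then show ?thesis using eval_A[of 0] red[of 0] by (simp add: T(1))
  next
    case False
    then obtain k where "x = g ^ k" using g by (auto simp: primitive_element_def)
    moreover have "g ^ p ^ s = g" by (simp add: n(2) g_power_n)
    ultimately show ?thesis
      using power_A[of "p ^ s * k"] red_power[of "p ^ s * k"] by (simp add: T(2) power_mult)
  qed
  have "teichmueller p s A red T (w ^ n)"
  proof
    show "1 \<in> A" "red 1 = 1" using power_A[of 0] red_power[of 0] by simp_all
    fix a b assume "a \<in> A" "b \<in> A"
    then obtain h k where "a = eval_int_poly h w" "b = eval_int_poly k w" by (auto simp: A_def)
    then show "a - b \<in> A" "a * b \<in> A" "red (a - b) = red a - red b" "red (a * b) = red a * red b"
      by (simp_all add: eval_A red flip: eval_int_poly_diff eval_int_poly_mult)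
  qed (use p card T T_red w power_A red_power g_power_n in auto)
  then show ?thesis by (rule that)
qed

section \<open>The additive character\<close>

context teichmueller
begin

definition q :: nat where "q = p ^ s"

lemma card_q: "CARD('a) = q"
  by (simp add: q_def card_field)

lemma q_ge_2: "q \<ge> 2"
  using card_field_ge_2[where 'a = 'a] by (simp add: card_q)

lemma s_pos: "s > 0"
  using q_ge_2 unfolding q_def by (cases s) auto

lemma p_ge_2: "p \<ge> 2"
  using prime_ge_2_nat[OF prime_p] .

lemma CHAR_p: "CHAR('a) = p"
  by (rule finite_field_CHAR[OF prime_p card_field])

lemma of_nat_field_eq_0_iff: "(of_nat n :: 'a) = 0 \<longleftrightarrow> p dvd n"
  by (simp add: of_nat_eq_0_iff_char_dvd CHAR_p)

lemma of_nat_q: "(of_nat q :: 'a) = 0"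
  using s_pos by (simp add: of_nat_field_eq_0_iff q_def)

lemma power_q: "(x :: 'a) ^ q = x"
proof (cases "x = 0")
  case False
  have "x ^ q = x * x ^ (q - 1)" using q_ge_2 by (cases q) auto
  then show ?thesis using finite_field_power_CARD_minus_1[OF False] by (simp add: card_q)
qed (use q_ge_2 in auto)

lemma zero_closed [simp]: "0 \<in> A"
  using diff_closed[OF one_closed one_closed] by simp

lemma red_0 [simp]: "red 0 = 0"
  using red_diff[OF one_closed one_closed] by simp

lemma uminus_closed [simp]: "a \<in> A \<Longrightarrow> - a \<in> A"
  using diff_closed[OF zero_closed, of a] by simp

lemma red_uminus [simp]: "a \<in> A \<Longrightarrow> red (- a) = - red a"
  using red_diff[OF zero_closed, of a] by simp

lemma add_closed [simp]: "a \<in> A \<Longrightarrow> b \<in> A \<Longrightarrow> a + b \<in> A"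
  using diff_closed[of a "- b"] by simp

lemma red_add [simp]: "a \<in> A \<Longrightarrow> b \<in> A \<Longrightarrow> red (a + b) = red a + red b"
  using red_diff[of a "- b"] by simp

lemma power_closed [simp]: "a \<in> A \<Longrightarrow> a ^ k \<in> A"
  by (induction k) auto

lemma red_power [simp]: "a \<in> A \<Longrightarrow> red (a ^ k) = red a ^ k"
  by (induction k) auto

lemma of_nat_closed [simp]: "of_nat k \<in> A"
  by (induction k) auto

lemma red_of_nat [simp]: "red (of_nat k) = of_nat k"
  by (induction k) auto

lemma sum_closed: "(\<And>x. x \<in> B \<Longrightarrow> f x \<in> A) \<Longrightarrow> sum f B \<in> A"
  by (induction B rule: infinite_finite_induct) auto

lemma red_sum: "(\<And>x. x \<in> B \<Longrightarrow> f x \<in> A) \<Longrightarrow> red (sum f B) = (\<Sum>x\<in>B. red (f x))"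
  by (induction B rule: infinite_finite_induct) (auto simp: sum_closed)

lemma T_eq_iff: "T x = T y \<longleftrightarrow> x = y"
  by (metis red_T)

lemma T_1 [simp]: "T 1 = 1"
proof -
  have "T 1 * T 1 = T 1" by (simp flip: T_mult)
  moreover have "T 1 \<noteq> 0" using T_eq_iff[of 1 0] by simp
  ultimately show ?thesis by simp
qed

lemma T_power: "T (x ^ k) = T x ^ k"
  by (induction k) (auto simp: T_mult)

lemma T_prod: "T (\<Prod>x\<in>B. f x) = (\<Prod>x\<in>B. T (f x))"
  by (induction B rule: infinite_finite_induct) (auto simp: T_mult)

lemma T_power_q_minus_1: "x \<noteq> 0 \<Longrightarrow> T x ^ (q - 1) = 1"
  using finite_field_power_CARD_minus_1[of x] by (simp flip: T_power add: card_q)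

lemma sum_T_power:
  "(\<Sum>x\<in>UNIV. T x ^ k) =
     (if k = 0 then of_nat q else if (q - 1) dvd k then of_nat (q - 1) else 0)"
proof -
  consider "k = 0" | "k \<noteq> 0" "(q - 1) dvd k" | "\<not> (q - 1) dvd k" by auto
  then show ?thesis
  proof cases
    case 1
    then show ?thesis by (simp add: card_q)
  next
    case 2
    then obtain l where l: "k = (q - 1) * l" by auto
    have "(\<Sum>x\<in>UNIV. T x ^ k) = (\<Sum>x\<in>UNIV - {0::'a}. 1)"
      using 2 by (intro sum.mono_neutral_cong_right)
        (auto simp: l power_mult T_power_q_minus_1 simp del: One_nat_def)
    then show ?thesis using 2 by (simp add: card_q)
  next
    case 3
    obtain g :: 'a where g: "primitive_element g" using ex_primitive_element by blast
    then have g_neq_0: "g \<noteq> 0" by (simp add: primitive_element_def)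
    have "g ^ k \<noteq> 1"
      using primitive_element_power_eq_iff[OF g, of k 0] 3 by (auto simp: card_q)
    then have T_g_power: "T g ^ k \<noteq> 1" using T_eq_iff[of "g ^ k" 1] by (simp add: T_power)
    have "(\<Sum>x\<in>UNIV. T x ^ k) = (\<Sum>x\<in>UNIV. T (g * x) ^ k)"
      by (rule sum.reindex_bij_witness[of _ "\<lambda>x. g * x" "\<lambda>x. x / g"]) (use g_neq_0 in auto)
    also have "\<dots> = T g ^ k * (\<Sum>x\<in>UNIV. T x ^ k)"
      by (simp add: T_mult power_mult_distrib sum_distrib_left)
    finally show ?thesis using T_g_power 3 by auto
  qed
qed

lemma sum_T_inverse_power: "(\<Sum>x\<in>UNIV. T (inverse x) ^ k) = (\<Sum>x\<in>UNIV. T x ^ k)"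
  by (rule sum.reindex_bij_witness[of _ inverse inverse]) auto

lemma sum_field_power_eq_0:
  assumes "k < q - 1"
  shows "(\<Sum>x\<in>UNIV. (x :: 'a) ^ k) = 0"
proof -
  have "(\<Sum>x\<in>UNIV. (x :: 'a) ^ k) = red (\<Sum>x\<in>UNIV. T x ^ k)" by (simp add: red_sum)
  also have "\<dots> = 0" using assms by (auto simp: sum_T_power of_nat_q dest: dvd_imp_le)
  finally show ?thesis .
qed

definition trace :: "'a \<Rightarrow> 'a" where "trace x = (\<Sum>i<s. x ^ (p ^ i))"

lemma trace_add: "trace (x + y) = trace x + trace y"
  unfolding trace_def sum.distrib[symmetric]
  by (intro sum.cong refl freshmans_dream') (simp_all add: CHAR_p prime_p)

lemma sum_frobenius_shift: "(\<Sum>i<s. (x :: 'a) ^ (p ^ Suc i)) = trace x"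
proof -
  have "(\<Sum>i<s. x ^ (p ^ Suc i)) + x = (\<Sum>i<Suc s. x ^ (p ^ i))"
    by (subst sum.lessThan_Suc_shift) (simp add: add.commute)
  also have "\<dots> = trace x + x" by (simp add: trace_def power_q[unfolded q_def])
  finally show ?thesis by simp
qed

lemma trace_frobenius: "trace (x ^ p) = trace x"
  using sum_frobenius_shift[of x] by (simp add: trace_def flip: power_mult)

lemma trace_power_p: "trace x ^ p = trace x"
proof -
  have "trace x ^ p = (\<Sum>i<s. (x ^ (p ^ i)) ^ p)"
    unfolding trace_def by (intro freshmans_dream_sum) (simp_all add: CHAR_p prime_p)
  also have "\<dots> = trace x"
    using sum_frobenius_shift[of x] by (simp add: mult.commute flip: power_mult)
  finally show ?thesis .
qed

lemma ex_of_nat_eq_trace: "\<exists>k. of_nat k = trace x"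
  using power_CHAR_eq_self_iff[of "trace x"] trace_power_p[of x] p_ge_2 by (auto simp: CHAR_p)

lemma ex_trace_neq_0: "\<exists>x. trace x \<noteq> 0"
proof (rule ccontr)
  assume "\<nexists>x. trace x \<noteq> 0"
  then have trace_0: "trace x = 0" for x by blast
  define P :: "'a poly" where "P = (\<Sum>i<s. monom 1 (p ^ i))"
  have "coeff P 1 = (\<Sum>i<s. if i = 0 then 1 else 0)"
    unfolding P_def coeff_sum using p_ge_2 by (intro sum.cong) auto
  also have "\<dots> = 1" using s_pos by simp
  finally have "P \<noteq> 0" by auto
  then have "card {x. poly P x = 0} \<le> degree P" by (rule card_poly_roots_bound)
  moreover have "{x. poly P x = 0} = UNIV"
    using trace_0 by (auto simp: P_def poly_sum poly_monom trace_def)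
  moreover have "degree P \<le> p ^ (s - 1)" unfolding P_def
    by (intro degree_sum_le)
      (use p_ge_2 in \<open>auto simp: degree_monom_eq intro!: power_increasing\<close>)
  moreover have "p ^ (s - 1) < q"
    unfolding q_def using p_ge_2 s_pos by (intro power_strict_increasing) auto
  ultimately show False by (simp add: card_q)
qed

lemma \<xi>_power_cong:
  assumes "(of_nat k :: 'a) = of_nat l"
  shows "\<xi> ^ k = \<xi> ^ l"
  using assms
proof (induction k l rule: linorder_wlog)
  case (le k l)
  then have "(of_nat (l - k) :: 'a) = 0" by simp
  then obtain j where "l - k = p * j" by (auto simp only: of_nat_field_eq_0_iff)
  then have "l = k + p * j" using le by simp
  then show ?case by (simp add: power_add power_mult \<xi>_power_p)
qed simp

definition \<psi> :: "'a \<Rightarrow> 'b" where "\<psi> x = \<xi> ^ (SOME k. of_nat k = trace x)"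

lemma \<psi>_eq:
  assumes "of_nat k = trace x"
  shows "\<psi> x = \<xi> ^ k"
proof -
  have "of_nat (SOME k. of_nat k = trace x) = trace x" using assms by (rule someI)
  then show ?thesis unfolding \<psi>_def using assms by (intro \<xi>_power_cong) simp
qed

lemma \<psi>_add: "\<psi> (x + y) = \<psi> x * \<psi> y"
proof -
  obtain k l where traces: "of_nat k = trace x" "of_nat l = trace y"
    using ex_of_nat_eq_trace by blast
  have "\<psi> (x + y) = \<xi> ^ (k + l)" by (rule \<psi>_eq) (simp add: trace_add traces)
  then show ?thesis using traces by (simp add: \<psi>_eq power_add)
qed

lemma \<psi>_0 [simp]: "\<psi> 0 = 1"
proof -
  have "trace 0 = 0" using p_ge_2 by (simp add: trace_def power_0_left)
  then show ?thesis using \<psi>_eq[of 0 0] by simp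
qed

lemma \<psi>_sum: "\<psi> (\<Sum>x\<in>B. f x) = (\<Prod>x\<in>B. \<psi> (f x))"
  by (induction B rule: infinite_finite_induct) (auto simp: \<psi>_add)

lemma \<psi>_frobenius: "\<psi> (x ^ p) = \<psi> x"
  by (simp add: \<psi>_def trace_frobenius)

lemma \<psi>_minus_1: "\<exists>v\<in>A. \<psi> x - 1 = (\<xi> - 1) * v"
proof -
  obtain k where "of_nat k = trace x" using ex_of_nat_eq_trace by blast
  then have "\<psi> x - 1 = (\<xi> - 1) * (\<Sum>i<k. \<xi> ^ i)" by (simp add: \<psi>_eq power_diff_1_eq)
  then show ?thesis by (blast intro: sum_closed power_closed \<xi>_closed)
qed

lemma \<psi>_nontrivial: "\<exists>x. \<psi> x \<noteq> 1"
proof -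
  obtain x where "trace x \<noteq> 0" using ex_trace_neq_0 by blast
  moreover obtain k where k: "of_nat k = trace x" using ex_of_nat_eq_trace by blast
  ultimately have "\<not> p dvd k" using of_nat_field_eq_0_iff[of k] by simp
  then have "coprime p k" "k \<noteq> 0" using prime_p by (auto intro!: prime_imp_coprime gr0I)
  then have "gcd k p = 1" by (simp add: coprime_iff_gcd_eq_1 gcd.commute)
  then obtain a b where "k * a = p * b + 1" using bezout_nat[OF \<open>k \<noteq> 0\<close>, of p] by auto
  then have "(\<xi> ^ k) ^ a = (\<xi> ^ p) ^ b * \<xi>" by (simp flip: power_mult)
  then have "\<xi> ^ k \<noteq> 1" using \<xi>_neq_1 by (auto simp: \<xi>_power_p)
  then show ?thesis using \<psi>_eq[OF k] by metis
qed

lemma sum_\<psi>_mult: "(\<Sum>y\<in>UNIV. \<psi> (y * z)) = (if z = 0 then of_nat q else 0)"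
proof (cases "z = 0")
  case False
  obtain x where x: "\<psi> x \<noteq> 1" using \<psi>_nontrivial by blast
  have "(\<Sum>y\<in>UNIV. \<psi> (y * z)) = (\<Sum>y\<in>UNIV. \<psi> (y * z + x))"
    by (rule sum.reindex_bij_witness[of _ "\<lambda>y. y + x / z" "\<lambda>y. y - x / z"])
       (use False in \<open>auto simp: algebra_simps\<close>)
  also have "\<dots> = \<psi> x * (\<Sum>y\<in>UNIV. \<psi> (y * z))"
    by (simp add: \<psi>_add sum_distrib_left mult.commute)
  finally show ?thesis using x False by simp
qed (simp add: card_q)

section \<open>Order at the uniformizer\<close>

lemma one_plus_power_p:
  assumes "z \<in> A"
  obtains v where "v \<in> A" "(z + 1) ^ p = 1 + z ^ p + of_nat p * z * (1 + z * v)"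
proof -
  define c where "c k = (p choose k) div p" for k
  define v where "v = (\<Sum>k=2..<p. of_nat (c k) * z ^ (k - 2))"
  have "of_nat (p choose k) * z ^ k = of_nat p * z * (z * (of_nat (c k) * z ^ (k - 2)))"
    if "k \<in> {2..<p}" for k
  proof -
    have "p choose k = p * c k"
      unfolding c_def using that prime_p
      by (intro dvd_mult_div_cancel[symmetric] dvd_choose_prime) auto
    moreover have "k = Suc (Suc (k - 2))" using that by auto
    then have "z ^ k = z * (z * z ^ (k - 2))" by (metis power_Suc)
    ultimately show ?thesis by simp
  qed
  then have middle: "(\<Sum>k=2..<p. of_nat (p choose k) * z ^ k) = of_nat p * z * (z * v)"
    by (simp add: v_def sum_distrib_left)
  have atMost_p: "{..p} = {0, 1, p} \<union> {2..<p}" using p_ge_2 by auto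
  have "(z + 1) ^ p
      = (\<Sum>k\<in>{0, 1, p}. of_nat (p choose k) * z ^ k) + (\<Sum>k=2..<p. of_nat (p choose k) * z ^ k)"
    unfolding binomial_ring atMost_p using p_ge_2 by (subst sum.union_disjoint) auto
  also have "\<dots> = 1 + z ^ p + of_nat p * z * (1 + z * v)"
    unfolding middle using p_ge_2 by (simp add: algebra_simps)
  finally show ?thesis using that[of v] assms by (simp add: v_def sum_closed)
qed

lemma uniformizer_power_associated_p:
  obtains w where "w \<in> A" "red w \<noteq> 0" "(\<xi> - 1) ^ (p - 1) = of_nat p * w"
proof -
  define z where "z = \<xi> - 1"
  have z: "z \<in> A" "red z = 0" "z \<noteq> 0" using \<xi>_neq_1 by (simp_all add: z_def)
  obtain v where v: "v \<in> A" "(z + 1) ^ p = 1 + z ^ p + of_nat p * z * (1 + z * v)"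
    using one_plus_power_p[OF z(1)] by blast
  define u where "u = 1 + z * v"
  have u: "- u \<in> A" "red (- u) \<noteq> 0" using z v(1) by (simp_all add: u_def)
  have "(z + 1) ^ p = 1" by (simp add: z_def \<xi>_power_p)
  then have "z ^ p + of_nat p * z * u = 0" using v(2) by (simp add: u_def)
  moreover have "z ^ p = z * z ^ (p - 1)" using p_ge_2 by (cases p) auto
  ultimately have "z * (z ^ (p - 1) + of_nat p * u) = 0" by (simp add: algebra_simps)
  then have "z ^ (p - 1) = of_nat p * (- u)" using z(3) by (simp add: eq_neg_iff_add_eq_0)
  then show ?thesis using that[OF u] by (simp add: z_def)
qed

text \<open>Divisibility by a power of the uniformizer \<open>\<xi> - 1\<close> in the localization of \<open>A\<close> at the kernel
  of \<open>red\<close>; clearing denominators avoids constructing the localization.\<close>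

definition ord_ge :: "nat \<Rightarrow> 'b \<Rightarrow> bool" where
  "ord_ge k a \<longleftrightarrow> (\<exists>u\<in>A. red u \<noteq> 0 \<and> (\<exists>v\<in>A. u * a = (\<xi> - 1) ^ k * v))"

lemma ord_geI: "u \<in> A \<Longrightarrow> red u \<noteq> 0 \<Longrightarrow> v \<in> A \<Longrightarrow> u * a = (\<xi> - 1) ^ k * v \<Longrightarrow> ord_ge k a"
  unfolding ord_ge_def by blast

lemma ord_geE:
  assumes "ord_ge k a"
  obtains u v where "u \<in> A" "red u \<noteq> 0" "v \<in> A" "u * a = (\<xi> - 1) ^ k * v"
  using assms unfolding ord_ge_def by blast

lemma ord_ge_0_left: "a \<in> A \<Longrightarrow> ord_ge 0 a"
  by (rule ord_geI[of 1 a]) simp_all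

lemma ord_ge_0_right: "ord_ge k 0"
  by (rule ord_geI[of 1 0]) simp_all

lemma ord_ge_uniformizer_power: "v \<in> A \<Longrightarrow> ord_ge k ((\<xi> - 1) ^ k * v)"
  by (rule ord_geI[of 1 v]) simp_all

lemma ord_ge_mult:
  assumes "ord_ge k a" "ord_ge l b"
  shows "ord_ge (k + l) (a * b)"
proof -
  obtain u v where u: "u \<in> A" "red u \<noteq> 0" "v \<in> A" "u * a = (\<xi> - 1) ^ k * v"
    using assms(1) by (rule ord_geE)
  obtain u' v' where u': "u' \<in> A" "red u' \<noteq> 0" "v' \<in> A" "u' * b = (\<xi> - 1) ^ l * v'"
    using assms(2) by (rule ord_geE)
  have "u * u' * (a * b) = (u * a) * (u' * b)" by simp
  also have "\<dots> = (\<xi> - 1) ^ (k + l) * (v * v')" unfolding u(4) u'(4) by (simp add: power_add)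
  finally show ?thesis using u u' by (intro ord_geI[of "u * u'" "v * v'"]) auto
qed

lemma ord_ge_mono:
  assumes "ord_ge k a" "l \<le> k"
  shows "ord_ge l a"
proof -
  obtain u v where u: "u \<in> A" "red u \<noteq> 0" "v \<in> A" "u * a = (\<xi> - 1) ^ k * v"
    using assms(1) by (rule ord_geE)
  have "(\<xi> - 1) ^ k = (\<xi> - 1) ^ l * (\<xi> - 1) ^ (k - l)" using assms(2) by (simp flip: power_add)
  then show ?thesis using u by (intro ord_geI[of u "(\<xi> - 1) ^ (k - l) * v"]) auto
qed

lemma ord_ge_add:
  assumes "ord_ge k a" "ord_ge k b"
  shows "ord_ge k (a + b)"
proof -
  obtain u v where u: "u \<in> A" "red u \<noteq> 0" "v \<in> A" "u * a = (\<xi> - 1) ^ k * v"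
    using assms(1) by (rule ord_geE)
  obtain u' v' where u': "u' \<in> A" "red u' \<noteq> 0" "v' \<in> A" "u' * b = (\<xi> - 1) ^ k * v'"
    using assms(2) by (rule ord_geE)
  have "u * u' * (a + b) = u' * (u * a) + u * (u' * b)" by (simp add: algebra_simps)
  also have "\<dots> = (\<xi> - 1) ^ k * (u' * v + u * v')" unfolding u(4) u'(4) by (simp add: algebra_simps)
  finally show ?thesis using u u' by (intro ord_geI[of "u * u'" "u' * v + u * v'"]) auto
qed

lemma ord_ge_sum: "(\<And>x. x \<in> B \<Longrightarrow> ord_ge k (f x)) \<Longrightarrow> ord_ge k (sum f B)"
  by (induction B rule: infinite_finite_induct) (auto simp: ord_ge_0_right ord_ge_add)

lemma ord_ge_prod: "(\<And>x. x \<in> B \<Longrightarrow> ord_ge (k x) (f x)) \<Longrightarrow> ord_ge (sum k B) (prod f B)"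
  by (induction B rule: infinite_finite_induct) (auto simp: ord_ge_0_left ord_ge_mult)

lemma ord_ge_cancel_unit:
  assumes "ord_ge k (b * a)" "b \<in> A" "red b \<noteq> 0"
  shows "ord_ge k a"
proof -
  obtain u v where "u \<in> A" "red u \<noteq> 0" "v \<in> A" "u * (b * a) = (\<xi> - 1) ^ k * v"
    using assms(1) by (rule ord_geE)
  then show ?thesis using assms by (intro ord_geI[of "u * b" v]) (auto simp: mult.assoc)
qed

lemma ord_ge_p: "ord_ge (p - 1) (of_nat p)"
proof -
  obtain w where "w \<in> A" "red w \<noteq> 0" "(\<xi> - 1) ^ (p - 1) = of_nat p * w"
    by (rule uniformizer_power_associated_p)
  then show ?thesis by (intro ord_geI[of w 1]) simp_all
qed

lemma ord_ge_q: "ord_ge (s * (p - 1)) (of_nat q)"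
proof -
  have "ord_ge (\<Sum>i<s. p - 1) (\<Prod>i<s. of_nat p)" by (intro ord_ge_prod ord_ge_p)
  then show ?thesis by (simp add: q_def)
qed

lemma ord_ge_cancel_p:
  assumes "ord_ge ((p - 1) + k) (of_nat p * a)"
  shows "ord_ge k a"
proof -
  obtain u v where u: "u \<in> A" "red u \<noteq> 0" "v \<in> A"
      "u * (of_nat p * a) = (\<xi> - 1) ^ ((p - 1) + k) * v"
    using assms by (rule ord_geE)
  obtain w where w: "w \<in> A" "(\<xi> - 1) ^ (p - 1) = of_nat p * w"
    by (rule uniformizer_power_associated_p)
  have "of_nat p * (u * a) = of_nat p * ((\<xi> - 1) ^ k * (w * v))"
    using u(4) w(2)[symmetric] by (simp add: power_add mult_ac)
  then have "u * a = (\<xi> - 1) ^ k * (w * v)" using p_ge_2 by simp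
  then show ?thesis using u w by (intro ord_geI[of u "w * v"]) auto
qed

lemma ord_ge_of_nat_imp_p_dvd:
  assumes "ord_ge k (of_nat N)" "k > 0"
  shows "p dvd N"
proof -
  obtain u v where u: "u \<in> A" "red u \<noteq> 0" "v \<in> A" "u * of_nat N = (\<xi> - 1) ^ k * v"
    using assms(1) by (rule ord_geE)
  have "red u * of_nat N = red (u * of_nat N)" using u(1) by simp
  also have "\<dots> = 0" unfolding u(4) using u(3) assms(2) by (simp add: power_0_left)
  finally show ?thesis using u(2) by (simp add: of_nat_field_eq_0_iff)
qed

lemma ord_ge_of_nat_imp_power_dvd:
  "ord_ge ((p - 1) * K) (of_nat N) \<Longrightarrow> p ^ K dvd N"
proof (induction K arbitrary: N)
  case (Suc K)
  have "p dvd N" using ord_ge_of_nat_imp_p_dvd[OF Suc.prems] p_ge_2 by simp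
  then obtain N' where N': "N = p * N'" ..
  have "ord_ge ((p - 1) * K) (of_nat N')"
    by (rule ord_ge_cancel_p) (use Suc.prems in \<open>simp add: N'\<close>)
  then show ?case using Suc.IH by (simp add: N')
qed simp

section \<open>Gauss sums\<close>

definition gauss_sum :: "nat \<Rightarrow> 'b" where
  "gauss_sum e = (\<Sum>t\<in>UNIV. \<psi> t * T (inverse t) ^ e)"

definition jacobi_sum :: "nat \<Rightarrow> nat \<Rightarrow> 'b" where
  "jacobi_sum a b = (\<Sum>x\<in>UNIV. T (inverse x) ^ a * T (inverse (1 - x)) ^ b)"

lemma jacobi_sum_closed [simp]: "jacobi_sum a b \<in> A"
  unfolding jacobi_sum_def by (intro sum_closed) simp

lemma bij_frobenius: "bij (\<lambda>x :: 'a. x ^ p)"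
proof -
  have "inj (\<lambda>x :: 'a. x ^ p)"
  proof (rule injI)
    fix x y :: 'a assume "x ^ p = y ^ p"
    then have "(x ^ p) ^ (p ^ (s - 1)) = (y ^ p) ^ (p ^ (s - 1))" by simp
    moreover have "p * p ^ (s - 1) = q" using s_pos unfolding q_def by (cases s) auto
    ultimately show "x = y" by (simp add: power_q flip: power_mult)
  qed
  then show ?thesis by (simp add: bij_def finite_UNIV_inj_surj)
qed

lemma gauss_sum_mult_p: "gauss_sum (p * e) = gauss_sum e"
proof -
  have "gauss_sum e = (\<Sum>t\<in>UNIV. \<psi> (t ^ p) * T (inverse (t ^ p)) ^ e)"
    unfolding gauss_sum_def using sum.reindex_bij_betw[OF bij_frobenius] by (rule sym)
  also have "\<dots> = gauss_sum (p * e)"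
    unfolding gauss_sum_def by (simp add: \<psi>_frobenius T_power power_mult flip: power_inverse)
  finally show ?thesis by simp
qed

lemma sum_T_inverse_convolution:
  assumes "\<not> (q - 1) dvd (a + b)"
  shows "(\<Sum>t\<in>UNIV. T (inverse t) ^ a * T (inverse (w - t)) ^ b)
    = T (inverse w) ^ (a + b) * jacobi_sum a b"
proof (cases "w = 0")
  case True
  have sum_pos: "a + b > 0" using assms by (intro gr0I) auto
  have "T (inverse t) ^ a * T (inverse (w - t)) ^ b = T (- 1) ^ b * T (inverse t) ^ (a + b)" for t
  proof -
    have "T (inverse (w - t)) = T (- 1) * T (inverse t)" by (simp add: True flip: T_mult)
    then show ?thesis by (simp add: power_add power_mult_distrib)
  qed
  then have "(\<Sum>t\<in>UNIV. T (inverse t) ^ a * T (inverse (w - t)) ^ b)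
      = T (- 1) ^ b * (\<Sum>t\<in>UNIV. T (inverse t) ^ (a + b))"
    by (simp add: sum_distrib_left)
  also have "\<dots> = 0" using assms by (auto simp: sum_T_inverse_power sum_T_power)
  finally show ?thesis using sum_pos by (simp add: True)
next
  case False
  have "T (inverse (w * x)) ^ a * T (inverse (w - w * x)) ^ b
      = T (inverse w) ^ (a + b) * (T (inverse x) ^ a * T (inverse (1 - x)) ^ b)" for x
  proof -
    have "w - w * x = w * (1 - x)" by (simp add: algebra_simps)
    then show ?thesis by (simp add: T_mult power_add power_mult_distrib)
  qed
  moreover have "(\<Sum>t\<in>UNIV. T (inverse t) ^ a * T (inverse (w - t)) ^ b)
      = (\<Sum>x\<in>UNIV. T (inverse (w * x)) ^ a * T (inverse (w - w * x)) ^ b)"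
    by (rule sum.reindex_bij_witness[of _ "\<lambda>x. w * x" "\<lambda>t. t / w"]) (use False in auto)
  ultimately show ?thesis by (simp add: jacobi_sum_def sum_distrib_left)
qed

lemma gauss_sum_mult:
  assumes "\<not> (q - 1) dvd (a + b)"
  shows "gauss_sum a * gauss_sum b = jacobi_sum a b * gauss_sum (a + b)"
proof -
  have "gauss_sum a * gauss_sum b
      = (\<Sum>t\<in>UNIV. \<Sum>u\<in>UNIV. \<psi> (t + u) * (T (inverse t) ^ a * T (inverse u) ^ b))"
    unfolding gauss_sum_def sum_product by (simp add: \<psi>_add mult_ac)
  also have "\<dots> = (\<Sum>t\<in>UNIV. \<Sum>w\<in>UNIV. \<psi> w * (T (inverse t) ^ a * T (inverse (w - t)) ^ b))"
  proof (rule sum.cong)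
    fix t :: 'a
    show "(\<Sum>u\<in>UNIV. \<psi> (t + u) * (T (inverse t) ^ a * T (inverse u) ^ b))
        = (\<Sum>w\<in>UNIV. \<psi> w * (T (inverse t) ^ a * T (inverse (w - t)) ^ b))"
      by (rule sum.reindex_bij_witness[of _ "\<lambda>w. w - t" "\<lambda>u. t + u"]) auto
  qed simp
  also have "\<dots> = (\<Sum>w\<in>UNIV. \<psi> w * (\<Sum>t\<in>UNIV. T (inverse t) ^ a * T (inverse (w - t)) ^ b))"
    by (subst sum.swap) (simp add: sum_distrib_left)
  also have "\<dots> = (\<Sum>w\<in>UNIV. jacobi_sum a b * (\<psi> w * T (inverse w) ^ (a + b)))"
    by (simp only: sum_T_inverse_convolution[OF assms] mult_ac)
  finally show ?thesis by (simp add: gauss_sum_def sum_distrib_left)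
qed

text \<open>After \<open>y = 1 / x\<close> the summand is \<open>y\<^bsup>k+1\<^esup> / (y - 1)\<close>, a geometric sum plus \<open>1 / (y - 1)\<close>.\<close>

lemma red_jacobi_sum_1:
  assumes "k > 0" "k + 1 < q - 1"
  shows "red (jacobi_sum k 1) = - of_nat (k + 1)"
proof -
  have summand: "y ^ k * inverse (1 - inverse y) = (\<Sum>i<k + 1. y ^ i) + inverse (y - 1)"
    if "y \<noteq> 1" for y :: 'a
  proof -
    have "y ^ k * inverse (1 - inverse y) = y ^ (k + 1) / (y - 1)"
      using assms(1) that by (cases "y = 0") (simp_all add: field_simps)
    also have "\<dots> = (y ^ (k + 1) - 1) / (y - 1) + 1 / (y - 1)" by (simp flip: add_divide_distrib)
    also have "(y ^ (k + 1) - 1) / (y - 1) = (\<Sum>i<k + 1. y ^ i)"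
      unfolding power_diff_1_eq using that by simp
    finally show ?thesis by (simp add: inverse_eq_divide)
  qed
  have "red (jacobi_sum k 1) = (\<Sum>x\<in>UNIV. inverse x ^ k * inverse (1 - x))"
    unfolding jacobi_sum_def by (simp add: red_sum)
  also have "\<dots> = (\<Sum>y\<in>UNIV. y ^ k * inverse (1 - inverse y))"
    by (rule sum.reindex_bij_witness[of _ inverse inverse]) auto
  also have "\<dots> = (\<Sum>y\<in>UNIV - {1}. (\<Sum>i<k + 1. y ^ i) + inverse (y - 1))"
    by (rule sum.mono_neutral_cong_right) (auto simp: summand simp del: sum.lessThan_Suc)
  also have "\<dots> = (\<Sum>i<k + 1. \<Sum>y\<in>UNIV - {1}. y ^ i) + (\<Sum>y\<in>UNIV - {1}. inverse (y - 1))"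
    unfolding sum.distrib by (subst sum.swap) (rule refl)
  also have "(\<Sum>i<k + 1. \<Sum>y\<in>UNIV - {1 :: 'a}. y ^ i) = (\<Sum>i<k + 1. - 1)"
    using assms(2) by (intro sum.cong) (simp_all add: sum_diff1 sum_field_power_eq_0)
  also have "(\<Sum>y\<in>UNIV - {1 :: 'a}. inverse (y - 1)) = (\<Sum>z\<in>UNIV. inverse z)"
    by (rule sum.reindex_bij_witness_not_neutral
        [of "{}" "{0}" _ "\<lambda>z. z + 1" "\<lambda>y. y - 1"]) auto
  also have "\<dots> = (\<Sum>z\<in>UNIV. z)"
    by (rule sum.reindex_bij_witness[of _ inverse inverse]) auto
  also have "\<dots> = 0" using sum_field_power_eq_0[of 1] assms(2) by simp
  finally show ?thesis by (simp add: algebra_simps)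
qed

lemma ord_ge_gauss_sum_1:
  assumes "1 < q - 1"
  shows "ord_ge 1 (gauss_sum 1)"
proof -
  have "(\<Sum>t\<in>UNIV. T (inverse t)) = 0"
    using assms sum_T_power[of 1] sum_T_inverse_power[of 1] by (auto dest: dvd_imp_le)
  then have "gauss_sum 1 = (\<Sum>t\<in>UNIV. (\<psi> t - 1) * T (inverse t))"
    by (simp add: gauss_sum_def algebra_simps sum_subtractf)
  moreover have "ord_ge 1 ((\<psi> t - 1) * T (inverse t))" for t
  proof -
    obtain v where "v \<in> A" "\<psi> t - 1 = (\<xi> - 1) * v" using \<psi>_minus_1 by blast
    then show ?thesis
      using ord_ge_uniformizer_power[of "v * T (inverse t)" 1] by (simp add: mult.assoc)
  qed
  ultimately show ?thesis by (simp add: ord_ge_sum)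
qed

text \<open>The Jacobi sum relating \<open>gauss_sum k * gauss_sum 1\<close> to \<open>gauss_sum (k + 1)\<close> is a unit
  whenever adding 1 to \<open>k\<close> produces no carry.\<close>

lemma ord_ge_gauss_sum_Suc:
  assumes "k > 0" "Suc k < q - 1" "\<not> p dvd Suc k" "ord_ge n (gauss_sum k)"
  shows "ord_ge (Suc n) (gauss_sum (Suc k))"
proof -
  have "\<not> (q - 1) dvd (k + 1)" using assms(2) by (auto dest: dvd_imp_le)
  then have "gauss_sum k * gauss_sum 1 = jacobi_sum k 1 * gauss_sum (Suc k)"
    using gauss_sum_mult[of k 1] by simp
  moreover have "ord_ge (n + 1) (gauss_sum k * gauss_sum 1)"
    using assms by (intro ord_ge_mult ord_ge_gauss_sum_1) auto
  moreover have "red (jacobi_sum k 1) \<noteq> 0"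
  proof -
    have "red (jacobi_sum k 1) = - of_nat (Suc k)" using red_jacobi_sum_1[of k] assms by simp
    then show ?thesis using assms(3) by (simp add: of_nat_field_eq_0_iff del: of_nat_Suc)
  qed
  ultimately show ?thesis using ord_ge_cancel_unit[of "n + 1"] by simp
qed

lemma stickelberger_lower_bound:
  assumes "e > 0" "e < q - 1"
  shows "ord_ge (digit_sum p s e) (gauss_sum e)"
  using assms
proof (induction e rule: less_induct)
  case (less e)
  show ?case
  proof (cases "p dvd e")
    case True
    then obtain e' where e': "e = p * e'" ..
    with less.prems p_ge_2 have "e' > 0" "e' < e" by auto
    then have "ord_ge (digit_sum p s e') (gauss_sum e')" using less e' by auto
    moreover have "digit_sum p s e = digit_sum p s e'"
      unfolding e' using less.prems p_ge_2 by (intro digit_sum_base_mult) (auto simp: e' q_def)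
    ultimately show ?thesis by (simp add: e' gauss_sum_mult_p)
  next
    case False
    obtain k where k: "e = Suc k" using less.prems by (cases e) auto
    have digits: "digit_sum p s e = Suc (digit_sum p s k)"
      unfolding k using s_pos False k by (intro digit_sum_Suc) auto
    show ?thesis
    proof (cases "k = 0")
      case True
      then show ?thesis using ord_ge_gauss_sum_1 less.prems digits by (simp add: k)
    next
      case k_neq_0: False
      then have "ord_ge (digit_sum p s k) (gauss_sum k)" using less k by auto
      then show ?thesis
        unfolding digits unfolding k using less.prems k k_neq_0 False
        by (intro ord_ge_gauss_sum_Suc) auto
    qed
  qed
qed

lemma sum_T_power_atLeastAtMost:
  "(\<Sum>e=1..q - 1. T b ^ e) = (if b = 1 then of_nat (q - 1) else 0)"
proof (cases "b = 0 \<or> b = 1")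
  case False
  have "(\<Sum>e=1..q - 1. T b ^ e) = T b * (\<Sum>e<q - 1. T b ^ e)"
    by (simp add: sum_distrib_left sum.atLeast1_atMost_eq)
  moreover have "(T b - 1) * (\<Sum>e<q - 1. T b ^ e) = 0"
    using T_power_q_minus_1[of b] False by (simp flip: power_diff_1_eq)
  moreover have "T b \<noteq> 1" using False T_eq_iff[of b 1] by simp
  ultimately show ?thesis using False by simp
qed (auto intro!: sum.neutral)

lemma teichmueller_interpolation:
  "of_nat (q - 1) * \<phi> z = of_nat (q - 1) * \<phi> 0 * (1 - T z ^ (q - 1))
    + (\<Sum>e=1..q - 1. (\<Sum>t\<in>UNIV. \<phi> t * T (inverse t) ^ e) * T z ^ e)"
proof -
  have "(\<Sum>e=1..q - 1. (\<Sum>t\<in>UNIV. \<phi> t * T (inverse t) ^ e) * T z ^ e)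
      = (\<Sum>t\<in>UNIV. \<phi> t * (\<Sum>e=1..q - 1. T (inverse t * z) ^ e))"
    unfolding sum_distrib_left sum_distrib_right
    by (subst sum.swap) (simp add: T_mult power_mult_distrib mult.assoc)
  also have "\<dots> = (\<Sum>t\<in>UNIV. if t = z \<and> z \<noteq> 0 then of_nat (q - 1) * \<phi> z else 0)"
    unfolding sum_T_power_atLeastAtMost by (intro sum.cong) (auto simp: field_simps)
  also have "\<dots> = (if z = 0 then 0 else of_nat (q - 1) * \<phi> z)"
    by (cases "z = 0") simp_all
  finally show ?thesis using T_power_q_minus_1[of z] q_ge_2 by (auto simp: power_0_left)
qed

definition \<psi>_coeff :: "nat \<Rightarrow> 'b" where
  "\<psi>_coeff e = (if e = 0 then of_nat (q - 1) else if e = q - 1 then - of_nat q else gauss_sum e)"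

lemma \<psi>_expansion: "of_nat (q - 1) * \<psi> z = (\<Sum>e\<le>q - 1. \<psi>_coeff e * T z ^ e)"
proof -
  define n where "n = q - 1"
  have n: "n > 0" using q_ge_2 by (simp add: n_def)
  have "T (inverse t) ^ n = 1" if "t \<noteq> 0" for t
    using T_power_q_minus_1[of "inverse t"] that by (simp add: n_def)
  then have "gauss_sum n = (\<Sum>t\<in>UNIV - {0}. \<psi> t)"
    unfolding gauss_sum_def using n by (intro sum.mono_neutral_cong_right) auto
  also have "\<dots> = - 1" using sum_\<psi>_mult[of 1] by (simp add: sum_diff1)
  finally have top: "gauss_sum n = - 1" .
  have "of_nat n * \<psi> z = of_nat n * (1 - T z ^ n) + (\<Sum>e=1..n. gauss_sum e * T z ^ e)"
    using teichmueller_interpolation[of \<psi> z] by (simp add: gauss_sum_def n_def)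
  also have "{1..n} = insert n {1..<n}" using n by auto
  also have "of_nat n * (1 - T z ^ n) + (\<Sum>e\<in>insert n {1..<n}. gauss_sum e * T z ^ e)
      = \<psi>_coeff 0 + \<psi>_coeff n * T z ^ n + (\<Sum>e=1..<n. gauss_sum e * T z ^ e)"
  proof -
    have bottom: "\<psi>_coeff 0 = of_nat n" by (simp add: \<psi>_coeff_def n_def)
    have last: "\<psi>_coeff n = - of_nat (n + 1)"
      using n q_ge_2 by (simp add: \<psi>_coeff_def n_def)
    show ?thesis unfolding bottom last by (simp add: top algebra_simps)
  qed
  also have "(\<Sum>e=1..<n. gauss_sum e * T z ^ e) = (\<Sum>e=1..<n. \<psi>_coeff e * T z ^ e)"
    by (intro sum.cong) (auto simp: \<psi>_coeff_def n_def)
  also have "\<psi>_coeff 0 + \<psi>_coeff n * T z ^ n + \<dots>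
      = (\<Sum>e\<in>insert 0 (insert n {1..<n}). \<psi>_coeff e * T z ^ e)"
    using n by simp
  also have "insert 0 (insert n {1..<n}) = {..n}" by auto
  finally show ?thesis by (simp add: n_def)
qed

lemma ord_ge_\<psi>_coeff:
  assumes "e \<le> q - 1"
  shows "ord_ge (digit_sum p s e) (\<psi>_coeff e)"
proof -
  have "digit_sum p s (q - 1) = s * (p - 1)"
    unfolding q_def using p_ge_2 by (intro digit_sum_power_minus_1) simp
  then have "ord_ge (digit_sum p s (q - 1)) (- of_nat q)"
    using ord_ge_mult[OF ord_ge_q ord_ge_0_left[of "- 1"]] by simp
  then show ?thesis
    using assms stickelberger_lower_bound[of e] by (auto simp: \<psi>_coeff_def ord_ge_0_left)
qed

end

section \<open>Exponential sums\<close>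

definition total_exponent :: "'k set \<Rightarrow> ('k \<Rightarrow> 'v \<Rightarrow> nat) \<Rightarrow> ('k \<Rightarrow> nat) \<Rightarrow> 'v \<Rightarrow> nat" where
  "total_exponent K w e v = (\<Sum>k\<in>K. e k * w k v)"

lemma prod_monomial_power:
  fixes x :: "'v \<Rightarrow> 'c::comm_semiring_1"
  shows "(\<Prod>k\<in>K. (\<Prod>v\<in>V. x v ^ w k v) ^ e k) = (\<Prod>v\<in>V. x v ^ total_exponent K w e v)"
  unfolding total_exponent_def power_sum prod_power_distrib
  by (subst prod.swap) (simp add: power_mult[symmetric] mult.commute)

lemma sum_PiE_Plus:
  "(\<Sum>z\<in>PiE (V <+> U) (\<lambda>_. B). F z) =
    (\<Sum>x\<in>PiE V (\<lambda>_. B). \<Sum>y\<in>PiE U (\<lambda>_. B). F (case_sum x y))"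
  unfolding sum.cartesian_product
  by (rule sum.reindex_bij_witness[of _ "\<lambda>(x, y). case_sum x y" "\<lambda>z. (z \<circ> Inl, z \<circ> Inr)"])
    (auto simp: PiE_def Pi_def extensional_def comp_def surjective_sum split: sum.split)

text \<open>Averaging the hypothesis over the \<open>s\<close> cyclic rotations of the base-\<open>p\<close> digits of \<open>e\<close>
  turns the bound on \<open>\<Sum>k. e k\<close> into one on digit sums.\<close>

lemma digit_sum_lower_bound:
  fixes e :: "'k \<Rightarrow> nat"
  assumes q: "q = p ^ s" "q \<ge> 2" and K: "finite K"
    and bound: "\<And>e. (\<And>v. v \<in> V \<Longrightarrow> (q - 1) dvd total_exponent K w e v) \<Longrightarrow>
      (q - 1) * B \<le> (\<Sum>k\<in>K. e k) + (q - 1) * card {v\<in>V. total_exponent K w e v = 0}"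
    and e: "\<And>k. k \<in> K \<Longrightarrow> e k < q"
    and dvd: "\<And>v. v \<in> V \<Longrightarrow> (q - 1) dvd total_exponent K w e v"
  shows "s * (p - 1) * B
    \<le> (\<Sum>k\<in>K. digit_sum p s (e k)) + s * (p - 1) * card {v\<in>V. total_exponent K w e v = 0}"
proof -
  define c where "c = card {v\<in>V. total_exponent K w e v = 0}"
  have p: "p > 0" using q by (cases p; cases s) auto
  have rotated: "(q - 1) * B \<le> (\<Sum>k\<in>K. rotate_digits p s t (e k)) + (q - 1) * c" if "t < s" for t
  proof -
    let ?r = "\<lambda>k. rotate_digits p s t (e k)"
    have "total_exponent K w ?r v = 0 \<longleftrightarrow> total_exponent K w e v = 0" for v
      using K that by (simp add: total_exponent_def rotate_digits_eq_0_iff[OF p])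
    moreover have "(q - 1) dvd total_exponent K w ?r v" if "v \<in> V" for v
      using dvd[OF that] \<open>t < s\<close> p unfolding total_exponent_def q(1)
      by (intro dvd_sum_rotate_digits) auto
    ultimately show ?thesis using bound[of ?r] by (simp add: c_def)
  qed
  have "(\<Sum>t<s. (q - 1) * B) \<le> (\<Sum>t<s. (\<Sum>k\<in>K. rotate_digits p s t (e k)) + (q - 1) * c)"
    by (intro sum_mono rotated) simp
  also have "\<dots> = (\<Sum>k\<in>K. \<Sum>t<s. rotate_digits p s t (e k)) + s * (q - 1) * c"
    by (simp add: sum.distrib sum.swap[of _ K])
  finally have "(p - 1) * (s * (q - 1) * B)
      \<le> (p - 1) * ((\<Sum>k\<in>K. \<Sum>t<s. rotate_digits p s t (e k)) + s * (q - 1) * c)"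
    by (intro mult_left_mono) simp_all
  also have "\<dots> = (\<Sum>k\<in>K. (p - 1) * (\<Sum>t<s. rotate_digits p s t (e k))) + (p - 1) * (s * (q - 1) * c)"
    by (simp add: distrib_left sum_distrib_left)
  also have "(\<Sum>k\<in>K. (p - 1) * (\<Sum>t<s. rotate_digits p s t (e k)))
      = (q - 1) * (\<Sum>k\<in>K. digit_sum p s (e k))"
    unfolding sum_distrib_left[of "q - 1"] using e
    by (simp add: q(1) sum_rotate_digits[OF p] del: One_nat_def)
  finally have "(q - 1) * (s * (p - 1) * B)
      \<le> (q - 1) * ((\<Sum>k\<in>K. digit_sum p s (e k)) + s * (p - 1) * c)"
    by (simp add: distrib_left mult_ac)
  then show ?thesis using q(2) unfolding c_def by simp
qed

context teichmueller
begin

definition expansion_coeff :: "'k set \<Rightarrow> ('k \<Rightarrow> 'a) \<Rightarrow> ('k \<Rightarrow> nat) \<Rightarrow> 'b" where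
  "expansion_coeff K a e = (\<Prod>k\<in>K. \<psi>_coeff (e k) * T (a k) ^ e k)"

lemma ord_ge_expansion_coeff:
  assumes "\<And>k. k \<in> K \<Longrightarrow> e k \<le> q - 1"
  shows "ord_ge (\<Sum>k\<in>K. digit_sum p s (e k)) (expansion_coeff K a e)"
  unfolding expansion_coeff_def
proof (rule ord_ge_prod)
  fix k assume "k \<in> K"
  then show "ord_ge (digit_sum p s (e k)) (\<psi>_coeff (e k) * T (a k) ^ e k)"
    using ord_ge_mult[OF ord_ge_\<psi>_coeff ord_ge_0_left[of "T (a k) ^ e k"]] assms by simp
qed

lemma \<psi>_monomials_expansion:
  assumes "finite K"
  shows "of_nat (q - 1) ^ card K * \<psi> (\<Sum>k\<in>K. a k * (\<Prod>v\<in>V. x v ^ w k v))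
    = (\<Sum>e\<in>PiE K (\<lambda>_. {..q - 1}). expansion_coeff K a e * (\<Prod>v\<in>V. T (x v) ^ total_exponent K w e v))"
proof -
  let ?t = "\<lambda>k. a k * (\<Prod>v\<in>V. x v ^ w k v)"
  have "of_nat (q - 1) ^ card K * \<psi> (\<Sum>k\<in>K. ?t k) = (\<Prod>k\<in>K. of_nat (q - 1) * \<psi> (?t k))"
    by (simp add: \<psi>_sum prod.distrib)
  also have "\<dots> = (\<Prod>k\<in>K. \<Sum>e\<le>q - 1. \<psi>_coeff e * T (?t k) ^ e)"
    by (simp only: \<psi>_expansion)
  also have "\<dots> = (\<Sum>e\<in>PiE K (\<lambda>_. {..q - 1}). \<Prod>k\<in>K. \<psi>_coeff (e k) * T (?t k) ^ e k)"
    by (rule prod_sum_PiE) (use assms in auto)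
  also have "\<dots> = (\<Sum>e\<in>PiE K (\<lambda>_. {..q - 1}).
      expansion_coeff K a e * (\<Prod>v\<in>V. T (x v) ^ total_exponent K w e v))"
  proof (rule sum.cong)
    fix e
    have "T (?t k) = T (a k) * (\<Prod>v\<in>V. T (x v) ^ w k v)" for k
      by (simp add: T_mult T_prod T_power)
    then show "(\<Prod>k\<in>K. \<psi>_coeff (e k) * T (?t k) ^ e k)
        = expansion_coeff K a e * (\<Prod>v\<in>V. T (x v) ^ total_exponent K w e v)"
      by (simp add: expansion_coeff_def power_mult_distrib prod.distrib mult.assoc
          flip: prod_monomial_power)
  qed simp
  finally show ?thesis .
qed

lemma exponential_sum_expansion:
  assumes "finite K" "finite V"
  shows "of_nat (q - 1) ^ card K *
      (\<Sum>x\<in>PiE V (\<lambda>_. UNIV). \<psi> (\<Sum>k\<in>K. a k * (\<Prod>v\<in>V. x v ^ w k v)))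
    = (\<Sum>e\<in>PiE K (\<lambda>_. {..q - 1}).
        expansion_coeff K a e * (\<Prod>v\<in>V. \<Sum>t\<in>UNIV. T t ^ total_exponent K w e v))"
proof -
  have "(\<Sum>x\<in>PiE V (\<lambda>_. UNIV). \<Prod>v\<in>V. T (x v) ^ l v) = (\<Prod>v\<in>V. \<Sum>t\<in>UNIV. T t ^ l v)" for l
    by (rule prod_sum_PiE[symmetric]) (use assms in auto)
  then show ?thesis
    unfolding sum_distrib_left \<psi>_monomials_expansion[OF assms(1)]
    by (subst sum.swap) (simp flip: sum_distrib_left)
qed

lemma ord_ge_prod_sum_T_power:
  assumes "finite V" "\<And>v. v \<in> V \<Longrightarrow> (q - 1) dvd l v"
  shows "ord_ge (s * (p - 1) * card {v\<in>V. l v = 0}) (\<Prod>v\<in>V. \<Sum>t\<in>UNIV. T t ^ l v)"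
proof -
  have "ord_ge (\<Sum>v\<in>V. if l v = 0 then s * (p - 1) else 0) (\<Prod>v\<in>V. \<Sum>t\<in>UNIV. T t ^ l v)"
    using assms(2) ord_ge_q by (intro ord_ge_prod) (simp add: sum_T_power ord_ge_0_left)
  moreover have "(\<Sum>v\<in>V. if l v = 0 then s * (p - 1) else 0) = s * (p - 1) * card {v\<in>V. l v = 0}"
    using assms(1) by (simp add: sum.If_cases Int_def)
  ultimately show ?thesis by simp
qed

lemma prod_sum_T_power_eq_0:
  assumes "finite V" "v \<in> V" "\<not> (q - 1) dvd l v"
  shows "(\<Prod>v\<in>V. \<Sum>t\<in>UNIV. T t ^ l v) = 0"
proof -
  have "(\<Sum>t\<in>UNIV. T t ^ l v) = 0" using assms(3) by (auto simp: sum_T_power)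
  then show ?thesis using assms by (auto intro: prod_zero)
qed

theorem ord_ge_exponential_sum:
  fixes a :: "'k \<Rightarrow> 'a"
  assumes fin: "finite K" "finite V"
    and bound: "\<And>e. (\<And>v. v \<in> V \<Longrightarrow> (q - 1) dvd total_exponent K w e v) \<Longrightarrow>
      (q - 1) * B \<le> (\<Sum>k\<in>K. e k) + (q - 1) * card {v\<in>V. total_exponent K w e v = 0}"
  shows "ord_ge (s * (p - 1) * B)
    (\<Sum>x\<in>PiE V (\<lambda>_. UNIV). \<psi> (\<Sum>k\<in>K. a k * (\<Prod>v\<in>V. x v ^ w k v)))" (is "ord_ge _ ?S")
proof -
  have "ord_ge (s * (p - 1) * B)
      (expansion_coeff K a e * (\<Prod>v\<in>V. \<Sum>t\<in>UNIV. T t ^ total_exponent K w e v))"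
    if "e \<in> PiE K (\<lambda>_. {..q - 1})" for e
  proof (cases "\<forall>v\<in>V. (q - 1) dvd total_exponent K w e v")
    case True
    have e: "e k \<le> q - 1" if "k \<in> K" for k using \<open>e \<in> _\<close> that by (auto simp: PiE_def)
    have "s * (p - 1) * B \<le> (\<Sum>k\<in>K. digit_sum p s (e k))
        + s * (p - 1) * card {v\<in>V. total_exponent K w e v = 0}"
    proof (rule digit_sum_lower_bound[OF q_def q_ge_2 fin(1) bound])
      show "e k < q" if "k \<in> K" for k using e[OF that] q_ge_2 by simp
    qed (use True in auto)
    moreover have "ord_ge ((\<Sum>k\<in>K. digit_sum p s (e k))
          + s * (p - 1) * card {v\<in>V. total_exponent K w e v = 0})
        (expansion_coeff K a e * (\<Prod>v\<in>V. \<Sum>t\<in>UNIV. T t ^ total_exponent K w e v))"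
      using True e fin(2) by (intro ord_ge_mult ord_ge_expansion_coeff ord_ge_prod_sum_T_power) auto
    ultimately show ?thesis by (rule ord_ge_mono[rotated])
  next
    case False
    then show ?thesis using prod_sum_T_power_eq_0[OF fin(2)] ord_ge_0_right by force
  qed
  then have multiple: "ord_ge (s * (p - 1) * B) (of_nat (q - 1) ^ card K * ?S)"
    unfolding exponential_sum_expansion[OF fin] by (rule ord_ge_sum)
  have unit: "red (of_nat (q - 1) ^ card K) \<noteq> 0"
  proof -
    have "(of_nat (q - 1) :: 'a) = - 1" using q_ge_2 of_nat_q by (simp add: of_nat_diff)
    then show ?thesis by simp
  qed
  show ?thesis
    using multiple power_closed[OF of_nat_closed] unit by (rule ord_ge_cancel_unit)
qed

lemma sum_\<psi>_linear:
  assumes "finite J"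
  shows "(\<Sum>y\<in>PiE J (\<lambda>_. UNIV). \<psi> (\<Sum>j\<in>J. y j * z j)) =
    (if \<forall>j\<in>J. z j = 0 then of_nat q ^ card J else 0)"
proof -
  have "(\<Sum>y\<in>PiE J (\<lambda>_. UNIV). \<psi> (\<Sum>j\<in>J. y j * z j)) = (\<Prod>j\<in>J. \<Sum>t\<in>UNIV. \<psi> (t * z j))"
    unfolding \<psi>_sum by (rule prod_sum_PiE[symmetric]) (use assms in auto)
  also have "\<dots> = (\<Prod>j\<in>J. if z j = 0 then of_nat q else 0)" by (simp only: sum_\<psi>_mult)
  also have "\<dots> = (if \<forall>j\<in>J. z j = 0 then of_nat q ^ card J else 0)"
    using assms by (auto intro: prod_zero)
  finally show ?thesis .
qed

end

section \<open>Monomials in products of the \<open>f\<^sub>i(x\<^sub>i)\<close>\<close>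

text \<open>Representatives in \<open>{1..n}\<close> rather than \<open>{0..<n}\<close>, so that nonzero multiplicities stay
  nonzero.\<close>

definition positive_residue :: "nat \<Rightarrow> nat \<Rightarrow> nat" where
  "positive_residue n k = (if k = 0 then 0 else Suc ((k - 1) mod n))"

lemma positive_residue_le: "n > 0 \<Longrightarrow> positive_residue n k \<le> n"
  by (simp add: positive_residue_def Suc_le_eq)

lemma positive_residue_eq_0_iff [simp]: "positive_residue n k = 0 \<longleftrightarrow> k = 0"
  by (simp add: positive_residue_def)

lemma positive_residue_decomp: "k = positive_residue n k + n * ((k - 1) div n)"
  by (cases k) (simp_all add: positive_residue_def)

lemma omega_le_sum:
  fixes f :: "'a::{field,finite} poly" and \<Gamma> :: "nat \<Rightarrow> nat"
  assumes dvd: "(CARD('a) - 1) dvd (\<Sum>m\<in>exponents f. m * \<Gamma> m)"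
    and nonzero: "(\<Sum>m\<in>exponents f. m * \<Gamma> m) \<noteq> 0"
  shows "omega f \<le> (\<Sum>m\<in>exponents f. \<Gamma> m)"
proof -
  define n where "n = CARD('a) - 1"
  have n_pos: "n > 0" using card_field_ge_2[where 'a = 'a] by (simp add: n_def)
  define \<gamma> where "\<gamma> m = positive_residue n (\<Gamma> m)" for m
  have \<Gamma>_decomp: "\<Gamma> m = \<gamma> m + n * ((\<Gamma> m - 1) div n)" for m
    unfolding \<gamma>_def by (rule positive_residue_decomp)
  have "(\<Sum>m\<in>exponents f. m * \<Gamma> m)
      = (\<Sum>m\<in>exponents f. m * \<gamma> m + n * (m * ((\<Gamma> m - 1) div n)))"
    by (intro sum.cong refl) (metis \<Gamma>_decomp distrib_left mult.left_commute)
  also have "\<dots> = (\<Sum>m\<in>exponents f. m * \<gamma> m) + n * (\<Sum>m\<in>exponents f. m * ((\<Gamma> m - 1) div n))"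
    by (simp only: sum.distrib sum_distrib_left)
  finally have "n dvd (\<Sum>m\<in>exponents f. m * \<gamma> m)"
    using dvd by (metis dvd_add_times_triv_right_iff mult.commute n_def)
  then obtain k where k: "(\<Sum>m\<in>exponents f. m * \<gamma> m) = n * k" ..
  have "(\<Sum>m\<in>exponents f. m * \<gamma> m) \<noteq> 0"
    using nonzero by (simp add: \<gamma>_def finite_exponents)
  then have "k > 0" using k by (cases k) auto
  then have "(\<Sum>m\<in>exponents f. \<gamma> m) \<in> omega_sums f"
    unfolding omega_sums_def using k positive_residue_le[OF n_pos] by (fastforce simp: n_def \<gamma>_def)
  then have "omega f \<le> (\<Sum>m\<in>exponents f. \<gamma> m)"
    unfolding omega_def by (intro Min_le finite_omega_sums)
  also have "\<dots> \<le> (\<Sum>m\<in>exponents f. \<Gamma> m)"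
    by (intro sum_mono) (metis \<Gamma>_decomp le_add1)
  finally show ?thesis .
qed

text \<open>The monomials whose \<open>I\<close>-part occurs in a product of at most \<open>d\<close> of the \<open>f\<^sub>i(x\<^sub>i)\<close> with
  \<open>i \<in> I\<close>; \<open>\<kappa> i m\<close> counts the factors contributing \<open>x\<^sub>i\<^sup>m\<close>. Variables outside \<open>I\<close> are unrestricted.\<close>

definition product_monomials :: "'i set \<Rightarrow> ('i \<Rightarrow> 'a::zero poly) \<Rightarrow> nat \<Rightarrow> ('i \<Rightarrow> nat) set" where
  "product_monomials I f d = {w. \<exists>\<kappa>. (\<forall>i\<in>I. w i = (\<Sum>m\<in>exponents (f i). m * \<kappa> i m)) \<and>
      (\<Sum>i\<in>I. \<Sum>m\<in>exponents (f i). \<kappa> i m) \<le> d}"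

lemma product_monomials_mono: "d \<le> e \<Longrightarrow> product_monomials I f d \<subseteq> product_monomials I f e"
  by (fastforce simp: product_monomials_def)

lemma product_monomials_zero_on:
  assumes "\<And>i. i \<in> I \<Longrightarrow> w i = 0"
  shows "w \<in> product_monomials I f d"
  using assms by (auto simp: product_monomials_def intro!: exI[of _ "\<lambda>_ _. 0"])

lemma product_monomials_single:
  fixes f :: "'i \<Rightarrow> 'a::zero poly"
  assumes "finite I" "i \<in> I" "m \<in> exponents (f i)"
  shows "(\<lambda>j. if j = i then m else 0) \<in> product_monomials I f 1"
proof -
  define \<kappa> :: "'i \<Rightarrow> nat \<Rightarrow> nat" where "\<kappa> j n = (if j = i then if n = m then 1 else 0 else 0)" for j n
  have "(\<Sum>n\<in>exponents (f j). n * \<kappa> j n) = (if j = i then m else 0)" for j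
  proof -
    have "(\<Sum>n\<in>exponents (f j). n * \<kappa> j n) = (\<Sum>n\<in>exponents (f j). if n = m then \<kappa> j m * m else 0)"
      by (intro sum.cong) (auto simp: \<kappa>_def)
    then show ?thesis using assms(3) by (simp add: \<kappa>_def finite_exponents)
  qed
  moreover have "(\<Sum>n\<in>exponents (f j). \<kappa> j n) = (if j = i then 1 else 0)" for j
    using assms(3) by (simp add: \<kappa>_def finite_exponents)
  ultimately show ?thesis
    unfolding product_monomials_def using assms(1,2) by (intro CollectI exI[of _ \<kappa>]) simp
qed

lemma product_monomials_add:
  assumes "v \<in> product_monomials I f d" "w \<in> product_monomials I f e"
  shows "(\<lambda>i. v i + w i) \<in> product_monomials I f (d + e)"
proof -
  obtain \<kappa> where \<kappa>: "\<forall>i\<in>I. v i = (\<Sum>m\<in>exponents (f i). m * \<kappa> i m)"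
      "(\<Sum>i\<in>I. \<Sum>m\<in>exponents (f i). \<kappa> i m) \<le> d"
    using assms(1) by (auto simp: product_monomials_def)
  obtain \<kappa>' where \<kappa>': "\<forall>i\<in>I. w i = (\<Sum>m\<in>exponents (f i). m * \<kappa>' i m)"
      "(\<Sum>i\<in>I. \<Sum>m\<in>exponents (f i). \<kappa>' i m) \<le> e"
    using assms(2) by (auto simp: product_monomials_def)
  show ?thesis unfolding product_monomials_def
    by (intro CollectI exI[of _ "\<lambda>i m. \<kappa> i m + \<kappa>' i m"])
      (use \<kappa> \<kappa>' in \<open>simp add: sum.distrib distrib_left\<close>)
qed

lemma product_monomials_total_exponent:
  assumes "\<And>k. k \<in> K \<Longrightarrow> w k \<in> product_monomials I f (d k)"
  shows "total_exponent K w e \<in> product_monomials I f (\<Sum>k\<in>K. e k * d k)"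
  using assms
proof (induction K rule: infinite_finite_induct)
  case (insert k K)
  have "(\<lambda>i. n * w k i) \<in> product_monomials I f (n * d k)" for n
    by (induction n) (auto intro: product_monomials_zero_on product_monomials_add insert.prems)
  with insert have "(\<lambda>i. e k * w k i + total_exponent K w e i)
      \<in> product_monomials I f (e k * d k + (\<Sum>k\<in>K. e k * d k))"
    by (intro product_monomials_add) auto
  then show ?case using insert.hyps by (simp add: total_exponent_def)
qed (auto simp: total_exponent_def intro: product_monomials_zero_on)

lemma sum_omega_le:
  fixes f :: "'i \<Rightarrow> 'a::{field,finite} poly"
  assumes I: "finite I" and nonconstant: "\<And>i. i \<in> I \<Longrightarrow> degree (f i) > 0"
    and W: "W \<in> product_monomials I f d" "\<And>i. i \<in> I \<Longrightarrow> (CARD('a) - 1) dvd W i"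
  shows "(\<Sum>i\<in>I. omega (f i)) \<le> (CARD('a) - 1) * card {i\<in>I. W i = 0} + d"
proof -
  obtain \<kappa> where \<kappa>: "\<And>i. i \<in> I \<Longrightarrow> W i = (\<Sum>m\<in>exponents (f i). m * \<kappa> i m)"
      "(\<Sum>i\<in>I. \<Sum>m\<in>exponents (f i). \<kappa> i m) \<le> d"
    using W(1) by (auto simp: product_monomials_def)
  have "omega (f i) \<le> (if W i = 0 then CARD('a) - 1 else 0) + (\<Sum>m\<in>exponents (f i). \<kappa> i m)"
    if i: "i \<in> I" for i
  proof (cases "W i = 0")
    case True
    then show ?thesis using omega_bounds(2)[OF nonconstant[OF i]] by simp
  next
    case False
    then show ?thesis
      using omega_le_sum[where f = "f i" and \<Gamma> = "\<kappa> i"] W(2)[OF i] \<kappa>(1)[OF i] by simp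
  qed
  then have "(\<Sum>i\<in>I. omega (f i))
      \<le> (\<Sum>i\<in>I. (if W i = 0 then CARD('a) - 1 else 0) + (\<Sum>m\<in>exponents (f i). \<kappa> i m))"
    by (rule sum_mono)
  also have "\<dots> = (CARD('a) - 1) * card {i\<in>I. W i = 0} + (\<Sum>i\<in>I. \<Sum>m\<in>exponents (f i). \<kappa> i m)"
    using I by (simp add: sum.distrib sum.If_cases Int_def)
  finally show ?thesis using \<kappa>(2) by linarith
qed

lemma sum_multiplicities_gt:
  fixes \<alpha> d :: "'j \<Rightarrow> nat"
  assumes J: "finite J" and D: "\<And>j. j \<in> J \<Longrightarrow> d j \<le> D" "D \<ge> 1"
    and sum_less: "(\<Sum>j\<in>J. d j) + D * m < c + (\<Sum>j\<in>J. \<alpha> j * d j)"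
  shows "card J + m < (\<Sum>j\<in>J. \<alpha> j) + card {j\<in>J. \<alpha> j = 0} + c"
proof -
  define \<beta> where "\<beta> j = \<alpha> j + (if \<alpha> j = 0 then 1 else 0)" for j
  have "\<alpha> j * d j + D \<le> d j + D * \<beta> j" if "j \<in> J" for j
  proof (cases "\<alpha> j")
    case (Suc a)
    then show ?thesis using mult_left_mono[OF D(1)[OF that], of a] by (simp add: \<beta>_def mult.commute)
  qed (simp add: \<beta>_def)
  then have "(\<Sum>j\<in>J. \<alpha> j * d j + D) \<le> (\<Sum>j\<in>J. d j + D * \<beta> j)" by (rule sum_mono)
  then have "(\<Sum>j\<in>J. \<alpha> j * d j) + D * card J \<le> (\<Sum>j\<in>J. d j) + D * (\<Sum>j\<in>J. \<beta> j)"
    by (simp add: sum.distrib sum_distrib_left mult.commute)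
  moreover have "1 * c \<le> D * c" using D(2) by (rule mult_right_mono) simp
  ultimately have "D * (card J + m) < D * ((\<Sum>j\<in>J. \<beta> j) + c)"
    using sum_less unfolding distrib_left by linarith
  then have "card J + m < (\<Sum>j\<in>J. \<beta> j) + c" using D(2) by simp
  also have "(\<Sum>j\<in>J. \<beta> j) = (\<Sum>j\<in>J. \<alpha> j) + card {j\<in>J. \<alpha> j = 0}"
    using J by (simp add: \<beta>_def sum.distrib sum.If_cases Int_def)
  finally show ?thesis .
qed

section \<open>Substituting univariate polynomials\<close>

lemma mpoly_eval_single:
  "mpoly_eval (Poly_Mapping.single m c) x = c * (\<Prod>i\<in>UNIV. x i ^ Poly_Mapping.lookup m i)"
  by (simp add: mpoly_eval_def)

lemma mpoly_eval_add: "mpoly_eval (P + Q) x = mpoly_eval P x + mpoly_eval Q x"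
  unfolding mpoly_eval_def by (rule setsum_keys_plus_distrib) (auto simp: distrib_right)

lemma mpoly_eval_0 [simp]: "mpoly_eval 0 x = 0"
  by (simp add: mpoly_eval_def)

lemma mpoly_eval_sum: "mpoly_eval (\<Sum>b\<in>B. P b) x = (\<Sum>b\<in>B. mpoly_eval (P b) x)"
  by (induction B rule: infinite_finite_induct) (simp_all add: mpoly_eval_add)

lemma sum_single_lookup:
  fixes P :: "'k \<Rightarrow>\<^sub>0 'c::comm_monoid_add"
  shows "(\<Sum>m\<in>Poly_Mapping.keys P. Poly_Mapping.single m (Poly_Mapping.lookup P m)) = P"
  by (rule poly_mapping_eqI)
    (auto simp: lookup_sum lookup_single when_def in_keys_iff)

lemma mpoly_eval_mult: "mpoly_eval (P * Q) x = mpoly_eval P x * mpoly_eval Q x"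
proof -
  let ?s = "\<lambda>P m. Poly_Mapping.single m (Poly_Mapping.lookup P m)"
  have "P * Q = (\<Sum>m\<in>Poly_Mapping.keys P. \<Sum>l\<in>Poly_Mapping.keys Q. ?s P m * ?s Q l)"
    by (subst (1 2) sum_single_lookup[symmetric]) (rule sum_product)
  moreover have "mpoly_eval (?s P m * ?s Q l) x
      = mpoly_eval (?s P m) x * mpoly_eval (?s Q l) x" for m l
    by (simp add: mult_single mpoly_eval_single lookup_add power_add prod.distrib mult_ac)
  ultimately have "mpoly_eval (P * Q) x = (\<Sum>m\<in>Poly_Mapping.keys P. mpoly_eval (?s P m) x)
      * (\<Sum>l\<in>Poly_Mapping.keys Q. mpoly_eval (?s Q l) x)"
    by (simp add: mpoly_eval_sum sum_product)
  then show ?thesis by (simp only: sum_single_lookup flip: mpoly_eval_sum)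
qed

lemma mpoly_eval_1 [simp]: "mpoly_eval 1 x = 1"
  using mpoly_eval_single[of 0 1 x] by simp

lemma mpoly_eval_power: "mpoly_eval (P ^ k) x = mpoly_eval P x ^ k"
  by (induction k) (simp_all add: mpoly_eval_mult)

lemma mpoly_eval_prod: "mpoly_eval (\<Prod>b\<in>B. P b) x = (\<Prod>b\<in>B. mpoly_eval (P b) x)"
  by (induction B rule: infinite_finite_induct) (simp_all add: mpoly_eval_mult)

definition univariate :: "'n \<Rightarrow> 'a::comm_semiring_1 poly \<Rightarrow> ('n, 'a) mpoly" where
  "univariate i g =
    (\<Sum>m\<in>exponents g. Poly_Mapping.single (Poly_Mapping.single i m) (coeff g m))"

lemma mpoly_eval_univariate: "mpoly_eval (univariate i g) x = poly g (x i)"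
proof -
  have "(\<Prod>j\<in>UNIV. x j ^ Poly_Mapping.lookup (Poly_Mapping.single i m) j) = x i ^ m" for m
  proof -
    have "(\<Prod>j\<in>UNIV. x j ^ Poly_Mapping.lookup (Poly_Mapping.single i m) j)
        = (\<Prod>j\<in>UNIV. if j = i then x i ^ m else 1)"
      by (intro prod.cong) (auto simp: lookup_single when_def)
    then show ?thesis by simp
  qed
  then have "mpoly_eval (univariate i g) x = (\<Sum>m\<in>exponents g. coeff g m * x i ^ m)"
    by (simp add: univariate_def mpoly_eval_sum mpoly_eval_single)
  also have "\<dots> = poly g (x i)"
    unfolding poly_altdef
    by (rule sum.mono_neutral_left) (auto simp: exponents_def intro: le_degree)
  finally show ?thesis .
qed

definition mpoly_subst ::
    "('n \<Rightarrow> 'a::comm_semiring_1 poly) \<Rightarrow> ('n::finite, 'a) mpoly \<Rightarrow> ('n, 'a) mpoly" where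
  "mpoly_subst f P = (\<Sum>m\<in>Poly_Mapping.keys P. Poly_Mapping.single 0 (Poly_Mapping.lookup P m)
      * (\<Prod>i\<in>UNIV. univariate i (f i) ^ Poly_Mapping.lookup m i))"

lemma mpoly_eval_subst: "mpoly_eval (mpoly_subst f P) x = mpoly_eval P (\<lambda>i. poly (f i) (x i))"
  by (simp add: mpoly_subst_def mpoly_eval_sum mpoly_eval_mult mpoly_eval_single mpoly_eval_prod
      mpoly_eval_power mpoly_eval_univariate mpoly_eval_def[of P])

definition supported_on :: "('n \<Rightarrow> nat) set \<Rightarrow> ('n, 'a::zero) mpoly \<Rightarrow> bool" where
  "supported_on M P \<longleftrightarrow> Poly_Mapping.lookup ` Poly_Mapping.keys P \<subseteq> M"

lemma supported_on_mono: "supported_on M P \<Longrightarrow> M \<subseteq> N \<Longrightarrow> supported_on N P"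
  by (auto simp: supported_on_def)

lemma supported_on_single: "Poly_Mapping.lookup m \<in> M \<Longrightarrow> supported_on M (Poly_Mapping.single m c)"
  by (simp add: supported_on_def)

lemma supported_on_sum:
  assumes "\<And>b. b \<in> B \<Longrightarrow> supported_on M (P b)"
  shows "supported_on M (\<Sum>b\<in>B. P b)"
  using assms keys_sum[of P B] unfolding supported_on_def by blast

lemma supported_on_product_monomials_one:
  "supported_on (product_monomials I f d) (1 :: ('i, 'a::comm_semiring_1) mpoly)"
  by (simp add: supported_on_def product_monomials_zero_on)

lemma supported_on_product_monomials_mult:
  fixes P Q :: "('i, 'a::comm_semiring_1) mpoly"
  assumes "supported_on (product_monomials I f d) P" "supported_on (product_monomials I f e) Q"
  shows "supported_on (product_monomials I f (d + e)) (P * Q)"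
  unfolding supported_on_def
proof (rule image_subsetI)
  fix m assume "m \<in> Poly_Mapping.keys (P * Q)"
  then obtain k l where m: "m = k + l" "k \<in> Poly_Mapping.keys P" "l \<in> Poly_Mapping.keys Q"
    using keys_mult[of P Q] by blast
  then have "(\<lambda>i. Poly_Mapping.lookup k i + Poly_Mapping.lookup l i)
      \<in> product_monomials I f (d + e)"
    using assms by (intro product_monomials_add) (auto simp: supported_on_def)
  then show "Poly_Mapping.lookup m \<in> product_monomials I f (d + e)"
    by (simp add: m(1) lookup_add[abs_def] plus_poly_mapping.rep_eq)
qed

lemma supported_on_product_monomials_power:
  fixes P :: "('i, 'a::comm_semiring_1) mpoly"
  assumes "supported_on (product_monomials I f d) P"
  shows "supported_on (product_monomials I f (n * d)) (P ^ n)"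
  by (induction n)
    (simp_all add: supported_on_product_monomials_one supported_on_product_monomials_mult assms)

lemma supported_on_product_monomials_prod:
  fixes P :: "'b \<Rightarrow> ('i, 'a::comm_semiring_1) mpoly"
  assumes "\<And>b. b \<in> B \<Longrightarrow> supported_on (product_monomials I f (d b)) (P b)"
  shows "supported_on (product_monomials I f (\<Sum>b\<in>B. d b)) (\<Prod>b\<in>B. P b)"
  using assms
  by (induction B rule: infinite_finite_induct)
    (simp_all add: supported_on_product_monomials_one supported_on_product_monomials_mult)

lemma supported_on_univariate:
  assumes "finite I"
  shows "supported_on (product_monomials I f (if i \<in> I then 1 else 0)) (univariate i (f i))"
  unfolding univariate_def
proof (intro supported_on_sum supported_on_single)
  fix m assume m: "m \<in> exponents (f i)"
  have "Poly_Mapping.lookup (Poly_Mapping.single i m) = (\<lambda>j. if j = i then m else 0)"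
    by (auto simp: fun_eq_iff lookup_single when_def)
  then show "Poly_Mapping.lookup (Poly_Mapping.single i m)
      \<in> product_monomials I f (if i \<in> I then 1 else 0)"
    using product_monomials_single[of I i m f] assms m by (auto intro: product_monomials_zero_on)
qed

lemma supported_on_mpoly_subst:
  fixes P :: "('n::finite, 'a::comm_semiring_1) mpoly"
  shows "supported_on (product_monomials I f (deg_on I P)) (mpoly_subst f P)"
  unfolding mpoly_subst_def
proof (rule supported_on_sum)
  fix m assume m: "m \<in> Poly_Mapping.keys P"
  let ?d = "\<lambda>i. Poly_Mapping.lookup m i * (if i \<in> I then 1 else 0)"
  have "supported_on (product_monomials I f 0) (Poly_Mapping.single 0 (Poly_Mapping.lookup P m))"
    by (intro supported_on_single product_monomials_zero_on) simp
  then have "supported_on (product_monomials I f (0 + (\<Sum>i\<in>UNIV. ?d i)))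
      (Poly_Mapping.single 0 (Poly_Mapping.lookup P m)
        * (\<Prod>i\<in>UNIV. univariate i (f i) ^ Poly_Mapping.lookup m i))"
    by (intro supported_on_product_monomials_mult supported_on_product_monomials_prod
        supported_on_product_monomials_power supported_on_univariate) auto
  moreover have "0 + (\<Sum>i\<in>UNIV. ?d i) \<le> deg_on I P"
  proof -
    have "(\<Sum>i\<in>UNIV. ?d i) = (\<Sum>i\<in>I. Poly_Mapping.lookup m i)"
      by (rule sum.mono_neutral_cong_right) auto
    also have "\<dots> \<le> deg_on I P" unfolding deg_on_def using m by (intro Max_ge) auto
    finally show ?thesis by simp
  qed
  ultimately show "supported_on (product_monomials I f (deg_on I P))
      (Poly_Mapping.single 0 (Poly_Mapping.lookup P m)
        * (\<Prod>i\<in>UNIV. univariate i (f i) ^ Poly_Mapping.lookup m i))"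
    using supported_on_mono product_monomials_mono by blast
qed

section \<open>Counting zeros\<close>

text \<open>The terms of \<open>\<Sum>\<^sub>j y\<^sub>j G\<^sub>j(x)\<close>, a polynomial in the variables \<open>x\<^sub>i\<close>, indexed by \<open>Inl i\<close>, and
  \<open>y\<^sub>j\<close>, indexed by \<open>Inr j\<close>.\<close>

definition combination_terms ::
    "'j set \<Rightarrow> ('j \<Rightarrow> ('n, 'a::zero) mpoly) \<Rightarrow> ('j \<times> ('n \<Rightarrow>\<^sub>0 nat)) set" where
  "combination_terms J G = Sigma J (\<lambda>j. Poly_Mapping.keys (G j))"

definition combination_coeff :: "('j \<Rightarrow> ('n, 'a::zero) mpoly) \<Rightarrow> 'j \<times> ('n \<Rightarrow>\<^sub>0 nat) \<Rightarrow> 'a" where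
  "combination_coeff G k = Poly_Mapping.lookup (G (fst k)) (snd k)"

definition combination_exponent :: "'j \<times> ('n \<Rightarrow>\<^sub>0 nat) \<Rightarrow> 'n + 'j \<Rightarrow> nat" where
  "combination_exponent k =
    case_sum (Poly_Mapping.lookup (snd k)) (\<lambda>j. if j = fst k then 1 else 0)"

lemma finite_combination_terms: "finite J \<Longrightarrow> finite (combination_terms J G)"
  by (simp add: combination_terms_def)

lemma sum_combination_terms:
  fixes G :: "'j \<Rightarrow> ('n::finite, 'a::comm_semiring_1) mpoly"
  assumes "finite J"
  shows "(\<Sum>k\<in>combination_terms J G.
      combination_coeff G k * (\<Prod>v\<in>UNIV <+> J. case_sum x y v ^ combination_exponent k v))
    = (\<Sum>j\<in>J. y j * mpoly_eval (G j) x)"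
proof -
  have "combination_coeff G k * (\<Prod>v\<in>UNIV <+> J. case_sum x y v ^ combination_exponent k v)
      = y (fst k) * (Poly_Mapping.lookup (G (fst k)) (snd k)
          * (\<Prod>i\<in>UNIV. x i ^ Poly_Mapping.lookup (snd k) i))"
    if "k \<in> combination_terms J G" for k
  proof -
    have "(\<Prod>j\<in>J. y j ^ (if j = fst k then 1 else 0)) = (\<Prod>j\<in>J. if j = fst k then y j else 1)"
      by (intro prod.cong) auto
    also have "\<dots> = y (fst k)" using assms that by (auto simp: combination_terms_def)
    finally show ?thesis
      using assms by (simp add: combination_coeff_def combination_exponent_def prod.Plus mult_ac)
  qed
  then show ?thesis
    using assms
    by (simp add: combination_terms_def mpoly_eval_def sum_distrib_left sum.Sigma case_prod_beta)
qed

lemma sum_combination_terms_weighted: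
  assumes "finite J"
  shows "(\<Sum>k\<in>combination_terms J G. e k * g (fst k))
    = (\<Sum>j\<in>J. total_exponent (combination_terms J G) combination_exponent e (Inr j) * g j)"
proof -
  have "(\<Sum>j\<in>J. total_exponent (combination_terms J G) combination_exponent e (Inr j) * g j)
      = (\<Sum>k\<in>combination_terms J G. \<Sum>j\<in>J. if j = fst k then e k * g j else 0)"
    unfolding total_exponent_def combination_exponent_def sum_distrib_right
    by (subst sum.swap) (intro sum.cong, auto)
  also have "\<dots> = (\<Sum>k\<in>combination_terms J G. e k * g (fst k))"
    using assms by (intro sum.cong) (auto simp: combination_terms_def)
  finally show ?thesis ..
qed

lemma sum_omega_le_combination:
  fixes f :: "'n::finite \<Rightarrow> 'a::{field,finite} poly" and G :: "'j \<Rightarrow> ('n, 'a) mpoly"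
    and J :: "'j set" and e :: "'j \<times> ('n \<Rightarrow>\<^sub>0 nat) \<Rightarrow> nat"
  defines "E \<equiv> total_exponent (combination_terms J G) combination_exponent e"
  assumes J: "finite J" and nonconstant: "\<And>i. i \<in> I \<Longrightarrow> degree (f i) > 0"
    and G: "\<And>j. j \<in> J \<Longrightarrow> supported_on (product_monomials I f (d j)) (G j)"
    and dvd: "\<And>i. i \<in> I \<Longrightarrow> (CARD('a) - 1) dvd E (Inl i)"
  shows "(\<Sum>i\<in>I. omega (f i))
    \<le> (CARD('a) - 1) * card {i\<in>I. E (Inl i) = 0} + (\<Sum>j\<in>J. E (Inr j) * d j)"
proof -
  have "total_exponent (combination_terms J G) (\<lambda>k. Poly_Mapping.lookup (snd k)) e
      \<in> product_monomials I f (\<Sum>k\<in>combination_terms J G. e k * d (fst k))"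
    using G by (intro product_monomials_total_exponent)
      (auto simp: combination_terms_def supported_on_def image_subset_iff)
  moreover have "total_exponent (combination_terms J G) (\<lambda>k. Poly_Mapping.lookup (snd k)) e
      = (\<lambda>i. E (Inl i))"
    by (simp add: E_def total_exponent_def combination_exponent_def fun_eq_iff)
  ultimately have "(\<lambda>i. E (Inl i)) \<in> product_monomials I f (\<Sum>j\<in>J. E (Inr j) * d j)"
    by (simp add: sum_combination_terms_weighted[OF J] E_def)
  then show ?thesis using nonconstant dvd by (intro sum_omega_le) auto
qed

lemma combination_exponent_sum_ge:
  fixes f :: "'n::finite \<Rightarrow> 'a::{field,finite} poly" and G :: "'j \<Rightarrow> ('n, 'a) mpoly"
    and J :: "'j set" and e :: "'j \<times> ('n \<Rightarrow>\<^sub>0 nat) \<Rightarrow> nat"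
  defines "n \<equiv> CARD('a) - 1"
    and "E \<equiv> total_exponent (combination_terms J G) combination_exponent e"
  assumes J: "finite J" and nonconstant: "\<And>i. i \<in> I \<Longrightarrow> degree (f i) > 0"
    and G: "\<And>j. j \<in> J \<Longrightarrow> supported_on (product_monomials I f (d j)) (G j)"
    and D: "\<And>j. j \<in> J \<Longrightarrow> d j \<le> D" "D \<ge> 1"
    and omega: "n * ((\<Sum>j\<in>J. d j) + D * m) < (\<Sum>i\<in>I. omega (f i))"
    and dvd: "\<And>v. v \<in> UNIV <+> J \<Longrightarrow> n dvd E v"
  shows "n * (card J + Suc m)
    \<le> (\<Sum>k\<in>combination_terms J G. e k) + n * card {v \<in> UNIV <+> J. E v = 0}"
proof -
  define \<alpha> where "\<alpha> j = E (Inr j) div n" for j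
  have \<alpha>: "E (Inr j) = n * \<alpha> j" if "j \<in> J" for j
    using dvd[OF InrI[OF that]] by (simp add: \<alpha>_def)
  define c where "c = card {i\<in>I. E (Inl i) = 0}"
  have "(\<Sum>i\<in>I. omega (f i)) \<le> n * c + (\<Sum>j\<in>J. E (Inr j) * d j)"
    unfolding c_def n_def E_def
    by (rule sum_omega_le_combination)
      (use J nonconstant G dvd[OF InlI] in \<open>auto simp: n_def E_def\<close>)
  also have "(\<Sum>j\<in>J. E (Inr j) * d j) = n * (\<Sum>j\<in>J. \<alpha> j * d j)"
    by (simp add: \<alpha> sum_distrib_left mult.assoc)
  finally have "n * ((\<Sum>j\<in>J. d j) + D * m) < n * (c + (\<Sum>j\<in>J. \<alpha> j * d j))"
    using omega by (simp add: distrib_left)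
  then have "(\<Sum>j\<in>J. d j) + D * m < c + (\<Sum>j\<in>J. \<alpha> j * d j)" by simp
  then have "card J + m < (\<Sum>j\<in>J. \<alpha> j) + card {j\<in>J. \<alpha> j = 0} + c"
    using J D by (rule sum_multiplicities_gt[rotated 3])
  moreover have "c + card {j\<in>J. \<alpha> j = 0} \<le> card {v \<in> UNIV <+> J. E v = 0}"
  proof -
    have "c + card {j\<in>J. \<alpha> j = 0} = card ({i\<in>I. E (Inl i) = 0} <+> {j\<in>J. \<alpha> j = 0})"
      using J by (simp add: c_def card_Plus)
    also have "\<dots> \<le> card {v \<in> UNIV <+> J. E v = 0}" using J \<alpha> by (intro card_mono) auto
    finally show ?thesis .
  qed
  ultimately have "n * (card J + Suc m)
      \<le> n * (\<Sum>j\<in>J. \<alpha> j) + n * card {v \<in> UNIV <+> J. E v = 0}"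
    unfolding distrib_left[symmetric] by (intro mult_left_mono) auto
  also have "n * (\<Sum>j\<in>J. \<alpha> j) = (\<Sum>k\<in>combination_terms J G. e k)"
    using sum_combination_terms_weighted[OF J, where g = "\<lambda>_. 1" and G = G and e = e]
    by (simp add: \<alpha> sum_distrib_left flip: E_def)
  finally show ?thesis .
qed

context teichmueller
begin

lemma sum_\<psi>_combination:
  fixes G :: "'j \<Rightarrow> ('n::finite, 'a) mpoly"
  assumes "finite J"
  shows "(\<Sum>z\<in>PiE (UNIV <+> J) (\<lambda>_. UNIV). \<psi> (\<Sum>k\<in>combination_terms J G.
      combination_coeff G k * (\<Prod>v\<in>UNIV <+> J. z v ^ combination_exponent k v)))
    = of_nat (q ^ card J * card {x. \<forall>j\<in>J. mpoly_eval (G j) x = 0})"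
  unfolding sum_PiE_Plus sum_combination_terms[OF assms] sum_\<psi>_linear[OF assms]
  by (simp add: PiE_UNIV_domain sum.If_cases)

theorem q_power_dvd_card_common_zeros:
  fixes f :: "'n::finite \<Rightarrow> 'a poly" and G :: "'j \<Rightarrow> ('n, 'a) mpoly"
  assumes J: "finite J" and nonconstant: "\<And>i. i \<in> I \<Longrightarrow> degree (f i) > 0"
    and G: "\<And>j. j \<in> J \<Longrightarrow> supported_on (product_monomials I f (d j)) (G j)"
    and D: "\<And>j. j \<in> J \<Longrightarrow> d j \<le> D" "D \<ge> 1"
    and omega: "(q - 1) * ((\<Sum>j\<in>J. d j) + D * m) < (\<Sum>i\<in>I. omega (f i))"
  shows "q ^ Suc m dvd card {x. \<forall>j\<in>J. mpoly_eval (G j) x = 0}"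
proof -
  define N where "N = card {x. \<forall>j\<in>J. mpoly_eval (G j) x = 0}"
  have "ord_ge (s * (p - 1) * (card J + Suc m)) (of_nat (q ^ card J * N))"
    unfolding N_def sum_\<psi>_combination[OF J, symmetric]
  proof (rule ord_ge_exponential_sum)
    show "(q - 1) * (card J + Suc m) \<le> (\<Sum>k\<in>combination_terms J G. e k) + (q - 1) *
        card {v \<in> UNIV <+> J. total_exponent (combination_terms J G) combination_exponent e v = 0}"
      if "\<And>v. v \<in> UNIV <+> J \<Longrightarrow>
        (q - 1) dvd total_exponent (combination_terms J G) combination_exponent e v" for e
      unfolding card_q[symmetric]
      by (rule combination_exponent_sum_ge[OF J])
        (use that omega nonconstant G D in \<open>auto simp: card_q\<close>)
  qed (use J in \<open>auto simp: finite_combination_terms\<close>)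
  then have "ord_ge ((p - 1) * (s * (card J + Suc m))) (of_nat (q ^ card J * N))"
    by (simp only: mult_ac)
  then have "p ^ (s * (card J + Suc m)) dvd q ^ card J * N"
    by (rule ord_ge_of_nat_imp_power_dvd)
  then have "q ^ card J * q ^ Suc m dvd q ^ card J * N"
    by (simp only: power_mult power_add flip: q_def)
  then show ?thesis using q_ge_2 by (simp add: N_def)
qed

end

theorem CARD_power_dvd_card_common_zeros:
  fixes P :: "'j \<Rightarrow> ('n::finite, 'a::{field,finite}) mpoly" and f :: "'n \<Rightarrow> 'a poly"
  assumes card_field: "prime p" "CARD('a) = p ^ s"
    and J: "finite J" and nonconstant: "\<And>i. i \<in> I \<Longrightarrow> degree (f i) > 0"
    and D: "\<And>j. j \<in> J \<Longrightarrow> deg_on I (P j) \<le> D" "D \<ge> 1"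
    and omega: "(CARD('a) - 1) * ((\<Sum>j\<in>J. deg_on I (P j)) + D * m) < (\<Sum>i\<in>I. omega (f i))"
  shows "CARD('a) ^ Suc m dvd card {x. \<forall>j\<in>J. mpoly_eval (P j) (\<lambda>i. poly (f i) (x i)) = 0}"
proof -
  obtain A and red :: "complex \<Rightarrow> 'a" and T \<xi> where "teichmueller p s A red T \<xi>"
    using teichmueller_exists[OF card_field] by blast
  then interpret teichmueller p s A red T \<xi> .
  have "q ^ Suc m dvd card {x. \<forall>j\<in>J. mpoly_eval (mpoly_subst f (P j)) x = 0}"
    by (rule q_power_dvd_card_common_zeros[OF J])
      (use nonconstant D omega in \<open>auto simp: card_q intro: supported_on_mpoly_subst\<close>)
  then show ?thesis by (simp only: card_q mpoly_eval_subst)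
qed

lemma nat_ceiling_quotient_pred_less:
  fixes n d D w :: nat
  assumes "n > 0" "D > 0" "n * d < w"
  defines "k \<equiv> nat \<lceil>(real w / real n - real d) / real D\<rceil>"
  shows "k > 0" "n * (d + D * (k - 1)) < w"
proof -
  define z where "z = (real w / real n - real d) / real D"
  have less_iff: "n * (d + D * m) < w \<longleftrightarrow> real m < z" for m
  proof -
    have "real m < z \<longleftrightarrow> real (n * (d + D * m)) < real w"
      using assms(1,2) by (simp add: z_def field_simps)
    then show ?thesis by (simp only: of_nat_less_iff)
  qed
  have "z > 0" using less_iff[of 0] assms(3) by simp
  then have "k > 0" "real (k - 1) < z" unfolding k_def z_def[symmetric] by linarith+
  then show "k > 0" "n * (d + D * (k - 1)) < w" by (simp_all only: less_iff)
qed

theorem theorem1p14: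
  fixes p s q r :: nat
    and P :: "nat \<Rightarrow> ('n::finite, 'a::{field,finite}) mpoly"
    and f :: "'n \<Rightarrow> 'a poly"
    and I :: "'n set"
  assumes "prime p" and "q = p ^ s" and "CARD('a) = q"
    and "r \<ge> 1"
    and "\<And>j. j \<in> {1..r} \<Longrightarrow> P j \<noteq> 0"
    and "I \<noteq> {}"
    and "Max ((\<lambda>j. deg_on I (P j)) ` {1..r}) > 0"
    and "\<And>i. i \<in> I \<Longrightarrow> degree (f i) > 0"
    and "(q - 1) * (\<Sum>j=1..r. deg_on I (P j)) < (\<Sum>i\<in>I. omega (f i))"
  shows "q ^ nat \<lceil>((\<Sum>i\<in>I. real (omega (f i)) / (real q - 1)) - real (\<Sum>j=1..r. deg_on I (P j)))
                   / real (Max ((\<lambda>j. deg_on I (P j)) ` {1..r}))\<rceil>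
         dvd card {x :: 'n \<Rightarrow> 'a. \<forall>j\<in>{1..r}. mpoly_eval (P j) (\<lambda>i. poly (f i) (x i)) = 0}"
proof -
  define D where "D = Max ((\<lambda>j. deg_on I (P j)) ` {1..r})"
  define k where "k = nat \<lceil>(real (\<Sum>i\<in>I. omega (f i)) / real (q - 1)
    - real (\<Sum>j=1..r. deg_on I (P j))) / real D\<rceil>"
  have q: "CARD('a) = p ^ s" "q \<ge> 2" using assms(2,3) card_field_ge_2[where 'a = 'a] by simp_all
  have D: "D > 0" "\<And>j. j \<in> {1..r} \<Longrightarrow> deg_on I (P j) \<le> D" using assms(7) by (auto simp: D_def)
  have k: "k > 0" "(q - 1) * ((\<Sum>j=1..r. deg_on I (P j)) + D * (k - 1)) < (\<Sum>i\<in>I. omega (f i))"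
    using nat_ceiling_quotient_pred_less[OF _ D(1) assms(9)] q(2) unfolding k_def by auto
  have "CARD('a) ^ Suc (k - 1) dvd
      card {x. \<forall>j\<in>{1..r}. mpoly_eval (P j) (\<lambda>i. poly (f i) (x i)) = 0}"
    by (rule CARD_power_dvd_card_common_zeros[OF assms(1) q(1)]) (use assms(3,8) D k(2) in auto)
  then have "q ^ k dvd card {x. \<forall>j\<in>{1..r}. mpoly_eval (P j) (\<lambda>i. poly (f i) (x i)) = 0}"
    using k(1) assms(3) by simp
  then show ?thesis
    unfolding k_def D_def using q(2) by (simp add: sum_divide_distrib of_nat_diff)
qed

end
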